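(* Assume $\neg\mathbf{SH}$ (there exists a Suslin tree). Then there is an $\omega_1$-compact Type I surface containing no direction.
   Context: All spaces are Hausdorff and all functions are continuous unless otherwise specified. A space $X$ is Type I if $X=\bigcup_{\alpha<\omega_1}X_\alpha$ with each $X_\alpha$ open, $\overline{X_\alpha}$ Lindelöf, and $\overline{X_\alpha}\subset X_\beta$ whenever $\alpha<\beta$; Type I spaces are always assumed non-Lindelöf. A subset of a Type I space is bounded if it is contained in some $X_\alpha$, otherwise unbounded; a function into a Type I space is (un)bounded if its range is. Club means closed and unbounded. $\mathbb{L}_{\ge 0}$ is the closed long ray $\omega_1\times[0,1)$ with the lexicographic order topology (with $X_\alpha=[0,\alpha)$). A direction in a Type I space $X$ is a club $D\subset X$ such that for every continuous $f:X\to\mathbb{L}_{\ge 0}$, if $f$ is unbounded on $D$ then $f$ is unbounded on every club subset of $D$. A space is $\omega_1$-compact if it contains no uncountable closed discrete subset. A surface is a 2-dimensional manifold, with or without boundary, i.e. a connected Hausdorff space each of whose points has a neighborhood homeomorphic to $\mathbb{R}^2$ (or, for boundary points, to $\mathbb{R}\times\mathbb{R}_{\ge 0}$). *)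

theory Defs
  imports "HOL-Analysis.Analysis"
begin

unbundle cardinal_syntax

section \<open>The ordinal \<open>\<omega>\<^sub>1\<close>\<close>

typedef omega1 = "Field (cardSuc natLeq)"
  using Cinfinite_cardSuc[OF natLeq_Cinfinite] by (metis all_not_in_conv cinfinite_def finite.emptyI)

instantiation omega1 :: linorder
begin

definition less_eq_omega1 :: "omega1 \<Rightarrow> omega1 \<Rightarrow> bool" where
  "a \<le> b \<longleftrightarrow> (Rep_omega1 a, Rep_omega1 b) \<in> cardSuc natLeq"

definition less_omega1 :: "omega1 \<Rightarrow> omega1 \<Rightarrow> bool" where
  "a < b \<longleftrightarrow> a \<le> b \<and> a \<noteq> (b :: omega1)"

instance
proof -
  have wo: "Well_order (cardSuc natLeq)"
    using cardSuc_Card_order[OF natLeq_Card_order] by (simp add: card_order_on_def)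
  then have t: "trans (cardSuc natLeq)" and as: "antisym (cardSuc natLeq)"
    and rf: "refl_on (Field (cardSuc natLeq)) (cardSuc natLeq)"
    and tot: "total_on (Field (cardSuc natLeq)) (cardSuc natLeq)"
    by (auto simp: order_on_defs)
  have anti: "a = b" if "a \<le> b" "b \<le> a" for a b :: omega1
    using that antisymD[OF as] by (metis less_eq_omega1_def Rep_omega1_inject)
  show "OFCLASS(omega1, linorder_class)"
  proof
    fix a b c :: omega1
    show "a < b \<longleftrightarrow> a \<le> b \<and> \<not> b \<le> a"
      using anti refl_onD[OF rf Rep_omega1] by (auto simp: less_omega1_def less_eq_omega1_def)
    show "a \<le> a"
      using refl_onD[OF rf Rep_omega1] by (simp add: less_eq_omega1_def)
    show "a \<le> b \<Longrightarrow> b \<le> c \<Longrightarrow> a \<le> c"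
      unfolding less_eq_omega1_def by (rule transD[OF t])
    show "a \<le> b \<Longrightarrow> b \<le> a \<Longrightarrow> a = b"
      by (rule anti)
    show "a \<le> b \<or> b \<le> a"
      using tot Rep_omega1[of a] Rep_omega1[of b] refl_onD[OF rf Rep_omega1]
      unfolding less_eq_omega1_def total_on_def by metis
  qed
qed

end

instance omega1 :: wellorder
proof
  fix P :: "omega1 \<Rightarrow> bool" and a
  assume step: "\<And>x. (\<And>y. y < x \<Longrightarrow> P y) \<Longrightarrow> P x"
  have "wf (cardSuc natLeq - Id)"
    using cardSuc_Card_order[OF natLeq_Card_order]
    by (simp add: card_order_on_def well_order_on_def)
  then have "wf (inv_image (cardSuc natLeq - Id) Rep_omega1)"
    by (rule wf_inv_image)
  moreover have "inv_image (cardSuc natLeq - Id) Rep_omega1 = {(x, y). x < y}"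
    by (auto simp: less_omega1_def less_eq_omega1_def Rep_omega1_inject)
  ultimately have "wf {(x, y). x < (y::omega1)}" by simp
  then show "P a"
  proof (induction a rule: wf_induct_rule)
    case (less x)
    show ?case by (rule step) (simp add: less)
  qed
qed

lemma countable_iff_ordLeq_natLeq: "countable A \<longleftrightarrow> |A| \<le>o natLeq"
proof -
  have "countable A \<longleftrightarrow> |A| \<le>o |UNIV :: nat set|"
    by (simp add: countable_def card_of_ordLeq[symmetric])
  also have "\<dots> \<longleftrightarrow> |A| \<le>o natLeq"
    using card_of_nat by (meson ordIso_symmetric ordLeq_ordIso_trans)
  finally show ?thesis .
qed

text \<open>The next two facts characterise \<open>omega1\<close> as a well-order up to isomorphism.\<close>

lemma uncountable_omega1: "uncountable (UNIV :: omega1 set)"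
proof
  assume "countable (UNIV :: omega1 set)"
  moreover have "range Rep_omega1 = Field (cardSuc natLeq)"
    using type_definition.Rep_range[OF type_definition_omega1] .
  ultimately have c: "countable (Field (cardSuc natLeq))"
    by (metis countable_image)
  have "|Field (cardSuc natLeq)| \<le>o natLeq"
    using c by (simp add: countable_iff_ordLeq_natLeq)
  moreover have "|Field (cardSuc natLeq)| =o cardSuc natLeq"
    by (rule card_of_Field_ordIso[OF cardSuc_Card_order[OF natLeq_Card_order]])
  ultimately have "cardSuc natLeq \<le>o natLeq"
    by (meson ordIso_ordLeq_trans ordIso_symmetric)
  then show False
    using not_ordLess_ordLeq[OF cardSuc_greater[OF natLeq_Card_order]] by simp
qed

lemma countable_lessThan_omega1: "countable {..<a :: omega1}"
proof -
  let ?r = "cardSuc natLeq"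
  have "Rep_omega1 ` {..<a} = underS ?r (Rep_omega1 a)"
  proof (intro equalityI subsetI)
    fix x assume "x \<in> underS ?r (Rep_omega1 a)"
    then have x: "(x, Rep_omega1 a) \<in> ?r" "x \<noteq> Rep_omega1 a"
      by (auto simp: underS_def)
    then have "Rep_omega1 (Abs_omega1 x) = x"
      by (auto intro!: Abs_omega1_inverse FieldI1)
    with x show "x \<in> Rep_omega1 ` {..<a}"
      by (intro image_eqI[of _ _ "Abs_omega1 x"]) (auto simp: less_omega1_def less_eq_omega1_def)
  qed (auto simp: underS_def less_omega1_def less_eq_omega1_def Rep_omega1_inject)
  moreover have "|underS ?r (Rep_omega1 a)| <o ?r"
    by (rule card_of_underS[OF cardSuc_Card_order[OF natLeq_Card_order] Rep_omega1])
  then have "|underS ?r (Rep_omega1 a)| \<le>o natLeq"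
    by (simp add: cardSuc_ordLeq_ordLess[OF natLeq_Card_order card_of_Card_order])
  ultimately have "countable (Rep_omega1 ` {..<a})"
    by (simp add: countable_iff_ordLeq_natLeq)
  moreover have "inj_on Rep_omega1 {..<a}"
    by (simp add: inj_on_def Rep_omega1_inject)
  ultimately show ?thesis
    by (rule countable_image_inj_on)
qed

unbundle no cardinal_syntax


section \<open>The closed long ray\<close>

typedef long_ray = "(UNIV :: omega1 set) \<times> {0..<1::real}"
  by (intro exI[of _ "(undefined, 0)"]) auto

instantiation long_ray :: linorder
begin

definition less_eq_long_ray :: "long_ray \<Rightarrow> long_ray \<Rightarrow> bool" where
  "x \<le> y \<longleftrightarrow> (case (Rep_long_ray x, Rep_long_ray y) of
     ((a, s), (b, t)) \<Rightarrow> a < b \<or> a = b \<and> s \<le> t)"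

definition less_long_ray :: "long_ray \<Rightarrow> long_ray \<Rightarrow> bool" where
  "x < y \<longleftrightarrow> (case (Rep_long_ray x, Rep_long_ray y) of
     ((a, s), (b, t)) \<Rightarrow> a < b \<or> a = b \<and> s < t)"

instance
proof
  fix x y z :: long_ray
  show "x < y \<longleftrightarrow> x \<le> y \<and> \<not> y \<le> x"
    by (auto simp: less_eq_long_ray_def less_long_ray_def split: prod.splits)
  show "x \<le> x"
    by (auto simp: less_eq_long_ray_def split: prod.splits)
  show "x \<le> y \<Longrightarrow> y \<le> z \<Longrightarrow> x \<le> z"
    by (auto simp: less_eq_long_ray_def split: prod.splits)
  show "x \<le> y \<or> y \<le> x"
    by (auto simp: less_eq_long_ray_def split: prod.splits)
  show "x = y" if "x \<le> y" "y \<le> x"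
  proof -
    have "Rep_long_ray x = Rep_long_ray y"
      using that by (auto simp: less_eq_long_ray_def split: prod.splits)
    then show ?thesis
      by (simp add: Rep_long_ray_inject)
  qed
qed

end

instantiation long_ray :: linorder_topology
begin

definition open_long_ray :: "long_ray set \<Rightarrow> bool" where
  "open_long_ray = generate_topology (range (\<lambda>a. {..<a}) \<union> range (\<lambda>a. {a<..}))"

instance
  by standard (rule open_long_ray_def)

end

text \<open>The subspace \<open>[0, \<alpha>)\<close>, where \<open>\<alpha>\<close> is identified with the point \<open>(\<alpha>, 0)\<close>.\<close>

definition long_ray_below :: "omega1 \<Rightarrow> long_ray set" where
  "long_ray_below \<alpha> = {..<Abs_long_ray (\<alpha>, 0)}"


section \<open>Type I spaces and directions\<close>

text \<open>
  The cover \<open>U\<close> is kept as explicit data because boundedness refers to it.  The choice is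
  immaterial: two such covers of the same space have the same bounded sets, since each
  closure, being Lindelof, is contained in some member of the other cover.
\<close>

definition type_I_space :: "'a topology \<Rightarrow> (omega1 \<Rightarrow> 'a set) \<Rightarrow> bool" where
  "type_I_space X U \<longleftrightarrow>
     Hausdorff_space X \<and> \<not> Lindelof_space X \<and>
     topspace X = (\<Union>\<alpha>. U \<alpha>) \<and>
     (\<forall>\<alpha>. openin X (U \<alpha>)) \<and>
     (\<forall>\<alpha>. Lindelof_space (subtopology X (X closure_of U \<alpha>))) \<and>
     (\<forall>\<alpha> \<beta>. \<alpha> < \<beta> \<longrightarrow> X closure_of U \<alpha> \<subseteq> U \<beta>)"

definition bounded_wrt :: "(omega1 \<Rightarrow> 'a set) \<Rightarrow> 'a set \<Rightarrow> bool" where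
  "bounded_wrt U S \<longleftrightarrow> (\<exists>\<alpha>. S \<subseteq> U \<alpha>)"

definition club_in :: "'a topology \<Rightarrow> (omega1 \<Rightarrow> 'a set) \<Rightarrow> 'a set \<Rightarrow> bool" where
  "club_in X U C \<longleftrightarrow> closedin X C \<and> \<not> bounded_wrt U C"

definition direction_in :: "'a topology \<Rightarrow> (omega1 \<Rightarrow> 'a set) \<Rightarrow> 'a set \<Rightarrow> bool" where
  "direction_in X U D \<longleftrightarrow> club_in X U D \<and>
     (\<forall>f :: 'a \<Rightarrow> long_ray. continuous_map X euclidean f \<longrightarrow>
        \<not> bounded_wrt long_ray_below (f ` D) \<longrightarrow>
        (\<forall>C \<subseteq> D. club_in X U C \<longrightarrow> \<not> bounded_wrt long_ray_below (f ` C)))"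

definition omega1_compact :: "'a topology \<Rightarrow> bool" where
  "omega1_compact X \<longleftrightarrow>
     (\<forall>S. closedin X S \<and> subtopology X S = discrete_topology S \<longrightarrow> countable S)"


section \<open>Surfaces, with or without boundary\<close>

text \<open>
  A non-Lindelof Type I surface has exactly the cardinality of the continuum, so every such
  surface is homeomorphic to a topology whose points are elements of \<open>omega1 \<times> real \<times> real\<close>;
  fixing that point type in an existence claim is no restriction.
\<close>

definition surface :: "'a topology \<Rightarrow> bool" where
  "surface X \<longleftrightarrow> connected_space X \<and> Hausdorff_space X \<and>
     (\<forall>x \<in> topspace X. \<exists>N \<subseteq> topspace X. x \<in> X interior_of N \<and>
        (subtopology X N homeomorphic_space (euclidean :: (real \<times> real) topology) \<or>
         subtopology X N homeomorphic_space top_of_set ((UNIV :: real set) \<times> {0::real..})))"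


section \<open>Suslin trees\<close>

definition tree_order :: "'a set \<Rightarrow> 'a rel \<Rightarrow> bool" where
  "tree_order T r \<longleftrightarrow> partial_order_on T r \<and>
     (\<forall>t \<in> T. well_order_on (underS r t) (Restr r (underS r t)))"

text \<open>A Suslin tree is a tree of cardinality \<open>\<aleph>\<^sub>1\<close> all of whose chains and antichains are countable.\<close>

definition suslin_tree :: "'a set \<Rightarrow> 'a rel \<Rightarrow> bool" where
  "suslin_tree T r \<longleftrightarrow> tree_order T r \<and> (card_of T, cardSuc natLeq) \<in> ordIso \<and>
     (\<forall>C \<subseteq> T. C \<in> Chains r \<longrightarrow> countable C) \<and>
     (\<forall>A \<subseteq> T. (\<forall>a \<in> A. \<forall>b \<in> A. a \<noteq> b \<longrightarrow> (a, b) \<notin> r) \<longrightarrow> countable A)"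

end

theory Submission
  imports Defs
begin

text \<open>
  Thicken a Suslin tree to a surface.  Over every branch \<open>{s. s \<sqsubseteq> t}\<close> of the tree lies a strip
  \<open>\<real> \<times> [0, ht t + 1)\<close>.  Two branches that part at level \<open>\<beta>\<close> share their strips below level
  \<open>\<beta> + 1\<close>, the coordinate change there being the shift by \<open>c * y / (1 - y)\<close> at height \<open>(\<beta>, y)\<close>.
  It is the identity up to level \<open>\<beta>\<close>, so coordinates along a branch never degenerate at limit levels,
  and it becomes infinite as \<open>y\<close> tends to 1, so the two continuations are separated.

  An uncountable set of points meets uncountably many nodes, hence by the Suslin property it
  accumulates at some limit node with bounded first coordinates; so the surface is
  \<open>\<omega>\<^sub>1\<close>-compact.  A club \<open>D\<close> is unbounded above two incomparable nodes \<open>s\<close> and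
  \<open>s'\<close>; the height function truncated to the part above \<open>s\<close> is unbounded on \<open>D\<close>, but bounded on the
  part of \<open>D\<close> above \<open>s'\<close>.
\<close>

section \<open>Initial segments of the long ray\<close>

text \<open>Closed initial segments are countable, so the union of those ending in \<open>A\<close>
  is countable too and omits some point, which then lies above all of \<open>A\<close>.\<close>

lemma countable_omega1_bounded:
  fixes A :: "omega1 set"
  assumes "countable A"
  obtains \<beta> where "\<And>\<alpha>. \<alpha> \<in> A \<Longrightarrow> \<alpha> < \<beta>"
proof -
  have c: "countable {..a :: omega1}" for a
    using countable_lessThan_omega1[of a] by (simp add: ivl_disj_un(2)[symmetric])
  have "countable (\<Union>a\<in>A. {..a})"
    using assms c by blast
  then obtain \<beta> where "\<beta> \<notin> (\<Union>a\<in>A. {..a})"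
    using uncountable_omega1 by (metis UNIV_I countable_subset subsetI)
  then show ?thesis
    by (intro that[of \<beta>]) force
qed

definition omega1_suc :: "omega1 \<Rightarrow> omega1" where
  "omega1_suc \<alpha> = (LEAST \<beta>. \<alpha> < \<beta>)"

lemma less_omega1_suc_iff [simp]: "\<beta> < omega1_suc \<alpha> \<longleftrightarrow> \<beta> \<le> \<alpha>"
proof -
  obtain \<gamma> where "\<alpha> < \<gamma>"
    using countable_omega1_bounded[of "{\<alpha>}"] by auto
  then have "\<alpha> < omega1_suc \<alpha>"
    unfolding omega1_suc_def by (rule LeastI)
  moreover have "\<alpha> < \<beta> \<Longrightarrow> omega1_suc \<alpha> \<le> \<beta>"
    unfolding omega1_suc_def by (rule Least_le)
  ultimately show ?thesis
    by (meson leI le_less_trans not_le)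
qed

lemma omega1_suc_le_iff [simp]: "omega1_suc \<alpha> \<le> \<beta> \<longleftrightarrow> \<alpha> < \<beta>"
  using less_omega1_suc_iff[of \<beta> \<alpha>] by (simp flip: not_less)

section \<open>Level and fractional coordinates on the long ray\<close>

definition lray :: "omega1 \<Rightarrow> real \<Rightarrow> long_ray" where
  "lray \<alpha> s = Abs_long_ray (\<alpha>, s)"

definition lev :: "long_ray \<Rightarrow> omega1" where
  "lev l = fst (Rep_long_ray l)"

definition frac_part :: "long_ray \<Rightarrow> real" where
  "frac_part l = snd (Rep_long_ray l)"

lemma frac_part_bounds [simp]: "0 \<le> frac_part l" "frac_part l < 1"
  using Rep_long_ray[of l] by (auto simp: frac_part_def)

lemma not_frac_part_less_0 [simp]: "\<not> frac_part l < 0"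
  by (simp add: not_less)

lemma lray_simps [simp]:
  assumes "0 \<le> s" "s < 1"
  shows "lev (lray \<alpha> s) = \<alpha>" "frac_part (lray \<alpha> s) = s"
  using assms by (simp_all add: lev_def frac_part_def lray_def Abs_long_ray_inverse)

lemma lray_lev_frac_part [simp]: "lray (lev l) (frac_part l) = l"
  by (simp add: lray_def lev_def frac_part_def Rep_long_ray_inverse)

lemma less_long_ray_iff:
  "l < l' \<longleftrightarrow> lev l < lev l' \<or> lev l = lev l' \<and> frac_part l < frac_part l'"
  by (simp add: less_long_ray_def lev_def frac_part_def case_prod_beta)

lemma le_long_ray_iff:
  "l \<le> l' \<longleftrightarrow> lev l < lev l' \<or> lev l = lev l' \<and> frac_part l \<le> frac_part l'"
  by (simp add: less_eq_long_ray_def lev_def frac_part_def case_prod_beta)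

lemma less_lray_0_iff [simp]: "l < lray \<alpha> 0 \<longleftrightarrow> lev l < \<alpha>"
  using frac_part_bounds[of l] by (auto simp: less_long_ray_iff)

lemma lray_0_le_iff [simp]: "lray \<alpha> 0 \<le> l \<longleftrightarrow> \<alpha> \<le> lev l"
  by (simp flip: not_less)

lemma long_ray_below_eq: "long_ray_below \<alpha> = {l. lev l < \<alpha>}"
  by (auto simp: long_ray_below_def simp flip: lray_def)

text \<open>The condition \<open>lev l \<le> \<alpha>\<close> keeps the whole unit interval at level
  \<alpha>, so it describes the half-open segment [0, \<alpha> + 1), which is open.\<close>

lemma lev_le_eq: "{l. lev l \<le> \<alpha>} = {..<lray (omega1_suc \<alpha>) 0}"
  by auto

section \<open>Continuity of monotone maps, and initial segments as real half-lines\<close>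

text \<open>A monotone map can fail to be continuous only by skipping values, and an interval as
  image has no gaps.\<close>

lemma continuous_on_mono_interval_image:
  fixes f :: "'a::linorder_topology \<Rightarrow> real"
  assumes mono: "mono_on A f" and I: "is_interval (f ` A)"
  shows "continuous_on A f"
  unfolding continuous_on_def
proof (intro ballI order_tendstoI)
  have ev: "eventually (\<lambda>y. y \<in> A) (at x within A)" for x
    by (simp add: eventually_at_filter)
  fix x c assume x: "x \<in> A"
  show "eventually (\<lambda>y. c < f y) (at x within A)" if c: "c < f x"
  proof (cases "\<exists>y\<in>A. f y \<le> c")
    case True
    then obtain y where y: "y \<in> A" "f y \<le> c" by blast
    \<comment> \<open>Monotonicity is not strict here: points to the right of a preimage of
      \<open>c\<close> could still have value \<open>c\<close>. A value strictly in between avoids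
      this.\<close>
    obtain m where m: "c < m" "m < f x"
      using dense[OF c] by blast
    have "m \<in> f ` A"
      by (rule mem_is_interval_1_I[OF I, of "f y" "f x"]) (use x y m in auto)
    then obtain z where z: "z \<in> A" "f z = m" by auto
    then have "z < x"
      using mono_onD[OF mono, of x z] x m by (meson not_le)
    then have "eventually (\<lambda>y. z < y) (at x within A)"
      by (rule order_tendstoD(1)[OF tendsto_ident_at])
    then show ?thesis using ev[of x]
    proof eventually_elim
      case (elim y)
      then have "f z \<le> f y"
        using mono_onD[OF mono, of z y] z(1) by simp
      then show ?case using z(2) m by simp
    qed
  next
    case False
    show ?thesis
      by (rule eventually_mono[OF ev]) (use False in \<open>auto simp: not_le\<close>)
  qed
  show "eventually (\<lambda>y. f y < c) (at x within A)" if c: "f x < c"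
  proof (cases "\<exists>y\<in>A. c \<le> f y")
    case True
    then obtain y where y: "y \<in> A" "c \<le> f y" by blast
    obtain m where m: "f x < m" "m < c"
      using dense[OF c] by blast
    have "m \<in> f ` A"
      by (rule mem_is_interval_1_I[OF I, of "f x" "f y"]) (use x y m in auto)
    then obtain z where z: "z \<in> A" "f z = m" by auto
    then have "x < z"
      using mono_onD[OF mono, of z x] x m by (meson not_le)
    then have "eventually (\<lambda>y. y < z) (at x within A)"
      by (rule order_tendstoD(2)[OF tendsto_ident_at])
    then show ?thesis using ev[of x]
    proof eventually_elim
      case (elim y)
      then have "f y \<le> f z"
        using mono_onD[OF mono, of y z] z(1) by simp
      then show ?case using z(2) m by simp
    qed
  next
    case False
    show ?thesis
      by (rule eventually_mono[OF ev]) (use False in \<open>auto simp: not_le\<close>)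
  qed
qed

text \<open>Counterpart for the inverse parametrization, whose values lie in the long ray. A bound
  \<open>c\<close> below \<open>b\<close> is itself a value, and by strictness its preimage bounds
  the required neighbourhood; an upper bound beyond \<open>b\<close> holds trivially.\<close>

lemma continuous_on_strict_mono_lessThan_image:
  fixes f :: "'a::linorder_topology \<Rightarrow> 'b::linorder_topology"
  assumes mono: "strict_mono_on A f" and I: "f ` A = {..<b}"
  shows "continuous_on A f"
  unfolding continuous_on_def
proof (intro ballI order_tendstoI)
  have ev: "eventually (\<lambda>y. y \<in> A) (at x within A)" for x
    by (simp add: eventually_at_filter)
  have less: "f x < f y \<longleftrightarrow> x < y" if "x \<in> A" "y \<in> A" for x y
    using strict_mono_on_less[OF mono that] .
  fix x c assume x: "x \<in> A"
  then have xb: "f x < b" using I by auto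
  show "eventually (\<lambda>y. c < f y) (at x within A)" if c: "c < f x"
  proof -
    obtain z where z: "z \<in> A" "f z = c"
      using I c xb by (metis imageE lessThan_iff less_trans)
    then have "eventually (\<lambda>y. z < y) (at x within A)"
      using less[of z x] x c by (intro order_tendstoD(1)[OF tendsto_ident_at]) simp
    then show ?thesis using ev[of x]
      by eventually_elim (use less z in auto)
  qed
  show "eventually (\<lambda>y. f y < c) (at x within A)" if c: "f x < c"
  proof (cases "c < b")
    case True
    then obtain z where z: "z \<in> A" "f z = c"
      using I by (metis imageE lessThan_iff)
    then have "eventually (\<lambda>y. y < z) (at x within A)"
      using less[of x z] x c by (intro order_tendstoD(2)[OF tendsto_ident_at]) simp
    then show ?thesis using ev[of x]
      by eventually_elim (use less z in auto)
  next
    case False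
    show ?thesis
      using ev[of x]
    proof eventually_elim
      case (elim y)
      then have "f y \<in> {..<b}" using I by blast
      then show ?case using False by simp
    qed
  qed
qed

text \<open>
  The countably many levels below \<open>\<alpha>\<close> get weights with finite sum \<open>M\<close>, so that the
  initial segment of the long ray becomes \<open>[0, M)\<close>, which is then rescaled.
\<close>

lemma long_ray_initial_segment_homeomorphic:
  "{l. lev l \<le> \<alpha>} homeomorphic {0::real..}"
proof -
  define A where "A = {l. lev l \<le> \<alpha>}"
  define n where "n = to_nat_on {..\<alpha>}"
  define w where "w \<gamma> = (1/2::real) ^ n \<gamma>" for \<gamma>
  have "countable {..\<alpha>}"
    using countable_lessThan_omega1[of \<alpha>] by (simp add: ivl_disj_un(2)[symmetric])
  then have n: "inj_on n {..\<alpha>}"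
    unfolding n_def by (rule inj_on_to_nat_on)
  have wpos: "0 < w \<gamma>" for \<gamma>
    by (simp add: w_def)
  have "(\<lambda>k::nat. (1/2::real) ^ k) summable_on UNIV"
    by (rule norm_summable_imp_summable_on) (simp add: summable_geometric)
  then have "(\<lambda>k::nat. (1/2::real) ^ k) summable_on n ` {..\<alpha>}"
    by (rule summable_on_subset_banach) simp
  then have "w summable_on {..\<alpha>}"
    using summable_on_reindex[OF n, of "\<lambda>k. (1/2::real) ^ k"] by (simp add: o_def w_def[abs_def])
  then have sm: "w summable_on B" if "B \<subseteq> {..\<alpha>}" for B
    using that by (rule summable_on_subset_banach)
  define Sg where "Sg B = infsum w B" for B
  have Sg_mono: "Sg B \<le> Sg C" if "B \<subseteq> C" "C \<subseteq> {..\<alpha>}" for B C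
    unfolding Sg_def using that wpos
    by (intro infsum_mono_neutral sm) (auto intro: less_imp_le)
  have Sg_atMost: "Sg {..\<beta>} = Sg {..<\<beta>} + w \<beta>" if "\<beta> \<le> \<alpha>" for \<beta>
  proof -
    have "Sg (insert \<beta> {..<\<beta>}) = w \<beta> + Sg {..<\<beta>}"
      unfolding Sg_def by (rule infsum_insert) (use that in \<open>auto intro!: sm\<close>)
    moreover have "insert \<beta> {..<\<beta>} = {..\<beta>}" by auto
    ultimately show ?thesis by simp
  qed
  \<comment> \<open>\<open>G l\<close> is the weight of the segment before \<open>l\<close>: all
    earlier levels in full, and the traversed fraction of the current one.\<close>
  define G where "G l = Sg {..<lev l} + frac_part l * w (lev l)" for l
  define M where "M = Sg {..\<alpha>}"
  have G_lt: "G l < Sg {..lev l}" if "l \<in> A" for l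
    using that wpos[of "lev l"] by (simp add: G_def Sg_atMost A_def)
  have G_ge: "Sg {..<lev l} \<le> G l" for l
    using wpos[of "lev l"] by (simp add: G_def)
  have "0 \<le> Sg B" for B
    unfolding Sg_def using less_imp_le[OF wpos] by (rule infsum_nonneg)
  then have G0: "0 \<le> G l" for l
    using G_ge[of l] order_trans by blast
  have GM: "G l < M" if "l \<in> A" for l
    using G_lt[OF that] Sg_mono[of "{..lev l}" "{..\<alpha>}"] that by (force simp: A_def M_def)
  have Gmono: "G l < G l'" if "l < l'" "l \<in> A" "l' \<in> A" for l l'
  proof (cases "lev l < lev l'")
    case True
    have "G l < Sg {..lev l}" using G_lt that by simp
    also have "\<dots> \<le> Sg {..<lev l'}" using True that by (intro Sg_mono) (auto simp: A_def)
    also have "\<dots> \<le> G l'" by (rule G_ge)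
    finally show ?thesis .
  next
    case False
    then show ?thesis
      using that wpos[of "lev l'"] by (auto simp: less_long_ray_iff G_def)
  qed
  have Gsurj: "\<exists>l\<in>A. G l = z" if "0 \<le> z" "z < M" for z
  proof -
    \<comment> \<open>The level during which the running weight passes \<open>z\<close>.\<close>
    define \<beta> where "\<beta> = (LEAST \<beta>. z < Sg {..\<beta>})"
    have 1: "z < Sg {..\<beta>}" "\<beta> \<le> \<alpha>"
      using LeastI[of "\<lambda>\<beta>. z < Sg {..\<beta>}" \<alpha>] Least_le[of "\<lambda>\<beta>. z < Sg {..\<beta>}" \<alpha>] that
      by (auto simp: \<beta>_def M_def)
    \<comment> \<open>For limit \<beta>, minimality speaks only of the segments up to earlier
      levels. Each finite subset of \<open>{..<\<beta>}\<close> lies in the segment up to its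
      maximum, and bounding the finite sums bounds the infinite one.\<close>
    have "Sg {..<\<beta>} \<le> z"
      unfolding Sg_def
    proof (rule infsum_le_finite_sums)
      show "w summable_on {..<\<beta>}" using 1 by (intro sm) auto
      fix F assume F: "finite F" "F \<subseteq> {..<\<beta>}"
      show "sum w F \<le> z"
      proof (cases "F = {}")
        case False
        then have m: "Max F \<in> F" using F by simp
        then have "\<not> z < Sg {..Max F}"
          using F not_less_Least[of "Max F" "\<lambda>\<beta>. z < Sg {..\<beta>}"] by (auto simp: \<beta>_def)
        moreover have "sum w F \<le> Sg {..Max F}"
          using Sg_mono[of F "{..Max F}"] F m 1 by (force simp: Sg_def)
        ultimately show ?thesis by simp
      qed (use that in simp)
    qed
    define s where "s = (z - Sg {..<\<beta>}) / w \<beta>"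
    have s: "0 \<le> s" "s < 1"
      using \<open>Sg {..<\<beta>} \<le> z\<close> 1 wpos[of \<beta>] Sg_atMost[of \<beta>]
      by (auto simp: s_def divide_simps)
    then have "G (lray \<beta> s) = z" "lray \<beta> s \<in> A"
      using wpos[of \<beta>] 1 by (auto simp: G_def s_def A_def)
    then show ?thesis by blast
  qed
  \<comment> \<open>The map \<open>x / (M - x)\<close> stretches [0, M) to the half-line; its
    inverse \<open>M * z / (1 + z)\<close> is the witness for surjectivity below.\<close>
  define g where "g l = G l / (M - G l)" for l
  have gmono: "g l < g l'" if "l < l'" "l \<in> A" "l' \<in> A" for l l'
    unfolding g_def using Gmono[OF that] GM[OF that(2)] GM[OF that(3)] G0[of l]
    by (intro frac_less) auto
  then have sm_g: "strict_mono_on A g"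
    by (simp add: strict_mono_on_def)
  have g_img: "g ` A = {0..}"
  proof (intro equalityI subsetI)
    fix z assume "z \<in> g ` A"
    then show "z \<in> {0..}"
      using G0 GM by (auto simp: g_def intro!: divide_nonneg_pos)
  next
    fix z :: real assume z: "z \<in> {0..}"
    have "M > 0"
      using GM[of "lray \<alpha> 0"] G0[of "lray \<alpha> 0"] by (simp add: A_def)
    then have "0 \<le> M * z / (1 + z)" "M * z / (1 + z) < M"
      using z by (auto simp: divide_simps)
    then obtain l where l: "l \<in> A" "G l = M * z / (1 + z)"
      using Gsurj by blast
    have "M - M * z / (1 + z) = M / (1 + z)"
      using z by (simp add: field_simps)
    then have "g l = z"
      using l \<open>M > 0\<close> z by (simp add: g_def)
    then show "z \<in> g ` A" using l by blast
  qed
  have cont: "continuous_on A g"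
    by (rule continuous_on_mono_interval_image)
      (auto simp: g_img is_interval_1 strict_mono_on_imp_mono_on[OF sm_g])
  define k where "k = the_inv_into A g"
  have inj: "inj_on g A" using sm_g by (rule strict_mono_on_imp_inj_on)
  have kg: "k (g l) = l" if "l \<in> A" for l
    unfolding k_def using inj that by (rule the_inv_into_f_f)
  have k_img: "k ` {0..} = {..<lray (omega1_suc \<alpha>) 0}"
  proof -
    have "k ` {0..} = A"
      unfolding g_img[symmetric] image_image using kg by simp
    then show ?thesis by (simp add: A_def lev_le_eq)
  qed
  have "strict_mono_on {0..} k"
  proof (rule strict_mono_onI)
    fix x y :: real assume "x \<in> {0..}" "y \<in> {0..}" "x < y"
    moreover from this obtain l l' where "l \<in> A" "x = g l" "l' \<in> A" "y = g l'"
      unfolding g_img[symmetric] by auto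
    ultimately show "k x < k y"
      using strict_mono_on_less[OF sm_g, of l l'] by (simp add: kg)
  qed
  then have "continuous_on {0..} k"
    using k_img by (rule continuous_on_strict_mono_lessThan_image)
  then have "homeomorphism A {0..} g k"
    unfolding homeomorphism_def
  proof (intro conjI ballI)
    show "k ` {0..} = A"
      by (simp add: k_img A_def lev_le_eq)
    show "g (k z) = z" if "z \<in> {0..}" for z
      using that kg unfolding g_img[symmetric] by auto
  qed (use cont g_img kg in simp_all)
  then show ?thesis
    unfolding homeomorphic_def A_def by blast
qed

lemma Lindelof_space_top_of_set:
  fixes S :: "'a::second_countable_topology set"
  shows "Lindelof_space (top_of_set S)"
  unfolding Lindelof_space_def
proof (intro allI impI)
  fix \<U> assume U: "(\<forall>U\<in>\<U>. openin (top_of_set S) U) \<and> \<Union>\<U> = topspace (top_of_set S)"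
  obtain \<V> where "\<V> \<subseteq> \<U>" "countable \<V>" "\<Union>\<V> = \<Union>\<U>"
    by (rule Lindelof_openin[of \<U> S]) (use U in simp_all)
  then show "\<exists>\<V>. countable \<V> \<and> \<V> \<subseteq> \<U> \<and> \<Union>\<V> = topspace (top_of_set S)"
    using U by (intro exI[of _ \<V>]) simp
qed

section \<open>Combinatorics of Suslin trees\<close>

locale suslin =
  fixes T :: "'a set" and r :: "'a rel"
  assumes suslin: "suslin_tree T r"
begin

abbreviation le (infix "\<sqsubseteq>" 50) where "s \<sqsubseteq> t \<equiv> (s, t) \<in> r"
abbreviation less (infix "\<sqsubset>" 50) where "s \<sqsubset> t \<equiv> s \<in> underS r t"

section \<open>The tree order and its branches\<close>

lemma tree: "tree_order T r"
  using suslin by (simp add: suslin_tree_def)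

lemma le_refl: "t \<in> T \<Longrightarrow> t \<sqsubseteq> t"
  using tree by (auto simp: tree_order_def order_on_defs refl_on_def)

lemma le_in: "s \<sqsubseteq> t \<Longrightarrow> s \<in> T \<and> t \<in> T"
  using tree by (auto simp: tree_order_def order_on_defs)

lemma le_trans: "s \<sqsubseteq> t \<Longrightarrow> t \<sqsubseteq> u \<Longrightarrow> s \<sqsubseteq> u"
  using tree by (auto simp: tree_order_def order_on_defs dest: transD)

lemma le_antisym: "s \<sqsubseteq> t \<Longrightarrow> t \<sqsubseteq> s \<Longrightarrow> s = t"
  using tree by (auto simp: tree_order_def order_on_defs dest: antisymD)

lemma less_iff: "s \<sqsubset> t \<longleftrightarrow> s \<sqsubseteq> t \<and> s \<noteq> t"
  by (auto simp: underS_def)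

lemma less_in: "s \<sqsubset> t \<Longrightarrow> s \<in> T \<and> t \<in> T"
  using le_in by (auto simp: less_iff)

lemma less_le_trans: "s \<sqsubset> t \<Longrightarrow> t \<sqsubseteq> u \<Longrightarrow> s \<sqsubset> u"
  using le_trans le_antisym by (auto simp: less_iff)

lemma le_linear:
  assumes "s \<sqsubseteq> t" "s' \<sqsubseteq> t"
  shows "s \<sqsubseteq> s' \<or> s' \<sqsubset> s"
proof (cases "s = t \<or> s' = t \<or> s = s'")
  case True
  then show ?thesis
    using assms le_refl le_in by (auto simp: less_iff)
next
  case False
  then have "s \<sqsubset> t" "s' \<sqsubset> t"
    using assms by (auto simp: less_iff)
  moreover have "total_on (underS r t) (Restr r (underS r t))"
    using tree le_in[OF assms(1)] by (auto simp: tree_order_def order_on_defs)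
  ultimately show ?thesis
    using False by (auto simp: total_on_def less_iff)
qed

text \<open>If \<open>x\<close> in \<open>Q\<close> has predecessors in \<open>Q\<close>, the least
  of them in the well-ordered set below \<open>x\<close> is minimal in \<open>Q\<close>, because
  anything below it is also below \<open>x\<close>.\<close>

lemma wf_less: "wf {(s, t). s \<sqsubset> t}"
  unfolding wf_eq_minimal
proof (intro allI impI)
  fix Q :: "'a set" and x assume "x \<in> Q"
  show "\<exists>z\<in>Q. \<forall>y. (y, z) \<in> {(s, t). s \<sqsubset> t} \<longrightarrow> y \<notin> Q"
  proof (cases "underS r x \<inter> Q = {}")
    case False
    then obtain y where y: "y \<sqsubset> x" "y \<in> Q" by blast
    then have "wf (Restr r (underS r x) - Id)"
      using tree less_in[of y x] by (auto simp: tree_order_def well_order_on_def)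
    then obtain z where z: "z \<in> underS r x \<inter> Q"
        "\<And>u. (u, z) \<in> Restr r (underS r x) - Id \<Longrightarrow> u \<notin> underS r x \<inter> Q"
      using y by (elim wfE_min[of _ y "underS r x \<inter> Q"]) simp_all
    have "u \<notin> Q" if "u \<sqsubset> z" for u
      using z(1) z(2)[of u] that less_le_trans[of u z x] by (auto simp: less_iff)
    then show ?thesis
      using z(1) by (intro bexI[of _ z]) simp_all
  qed (use \<open>x \<in> Q\<close> in auto)
qed

text \<open>Supplies the first node on a branch with a given property; nodes of prescribed height,
  splitting nodes and accumulation nodes are all found this way.\<close>

lemma minimal_below:
  assumes "t \<in> T" "P t"
  shows "\<exists>s. s \<sqsubseteq> t \<and> P s \<and> (\<forall>u. u \<sqsubset> s \<longrightarrow> \<not> P u)"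
proof -
  obtain s where s: "s \<in> {s. s \<sqsubseteq> t \<and> P s}"
      "\<And>u. (u, s) \<in> {(s, t). s \<sqsubset> t} \<Longrightarrow> u \<notin> {s. s \<sqsubseteq> t \<and> P s}"
    by (rule wfE_min[OF wf_less, of t "{s. s \<sqsubseteq> t \<and> P s}"]) (use assms le_refl in simp_all)
  have "\<not> P u" if "u \<sqsubset> s" for u
    using s(2)[of u] less_le_trans[OF that, of t] s(1) that by (simp add: less_iff)
  then show ?thesis
    using s(1) by (intro exI[of _ s]) simp
qed

lemma countable_antichain:
  assumes "A \<subseteq> T" "\<And>a b. a \<in> A \<Longrightarrow> b \<in> A \<Longrightarrow> \<not> a \<sqsubset> b"
  shows "countable A"
proof -
  have "\<forall>A\<subseteq>T. (\<forall>a\<in>A. \<forall>b\<in>A. a \<noteq> b \<longrightarrow> \<not> a \<sqsubseteq> b) \<longrightarrow> countable A"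
    using suslin by (simp add: suslin_tree_def)
  moreover have "\<forall>a\<in>A. \<forall>b\<in>A. a \<noteq> b \<longrightarrow> \<not> a \<sqsubseteq> b"
    using assms(2) less_iff by blast
  ultimately show ?thesis
    using assms(1) by blast
qed

lemma countable_chain:
  assumes "A \<subseteq> T" "\<And>a b. a \<in> A \<Longrightarrow> b \<in> A \<Longrightarrow> a \<sqsubseteq> b \<or> b \<sqsubseteq> a"
  shows "countable A"
proof -
  have "\<forall>A\<subseteq>T. A \<in> Chains r \<longrightarrow> countable A"
    using suslin by (simp add: suslin_tree_def)
  moreover have "A \<in> Chains r"
    using assms(2) by (simp add: Chains_def)
  ultimately show ?thesis
    using assms(1) by blast
qed

lemma countable_less: "countable (underS r t)"
  using le_linear less_in by (intro countable_chain) (auto simp: less_iff)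

lemma card_T: "(card_of T, cardSuc natLeq) \<in> ordIso"
  using suslin by (simp add: suslin_tree_def)

lemma uncountable_T: "uncountable T"
proof
  assume "countable T"
  then have "(card_of T, natLeq) \<in> ordLeq"
    by (simp add: countable_iff_ordLeq_natLeq)
  then have "(cardSuc natLeq, natLeq) \<in> ordLeq"
    using card_T by (meson ordIso_ordLeq_trans ordIso_symmetric)
  then show False
    using not_ordLess_ordLeq[OF cardSuc_greater[OF natLeq_Card_order]] by simp
qed

lemma ex_inj_omega1: "\<exists>f :: 'a \<Rightarrow> omega1. inj_on f T"
proof -
  have "(card_of T, card_of (Field (cardSuc natLeq))) \<in> ordLeq"
    using card_T card_of_Field_ordIso[OF cardSuc_Card_order[OF natLeq_Card_order]]
    by (meson ordIso_iff_ordLeq ordIso_symmetric ordIso_transitive)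
  then obtain f where f: "inj_on f T" "f ` T \<subseteq> Field (cardSuc natLeq)"
    by (metis card_of_ordLeq)
  then have "inj_on (Abs_omega1 \<circ> f) T"
    by (intro comp_inj_on) (auto simp: inj_on_def Abs_omega1_inject subset_iff)
  then show ?thesis by blast
qed

section \<open>Heights, levels and ancestors\<close>

definition ht :: "'a \<Rightarrow> omega1" where
  "ht = wfrec {(s, t). s \<sqsubset> t} (\<lambda>h t. LEAST \<alpha>. \<forall>s. s \<sqsubset> t \<longrightarrow> h s < \<alpha>)"

lemma ht_eq: "ht t = (LEAST \<alpha>. \<forall>s. s \<sqsubset> t \<longrightarrow> ht s < \<alpha>)"
  unfolding ht_def by (subst wfrec[OF wf_less]) (simp add: cut_apply)

text \<open>A node has only countably many predecessors, so their heights have a bound in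
  \<open>omega1\<close> and the \<open>LEAST\<close> describing \<open>ht t\<close> is
  attained.\<close>

lemma ht_less: "s \<sqsubset> t \<Longrightarrow> ht s < ht t"
proof -
  assume "s \<sqsubset> t"
  obtain \<beta> where "\<And>\<alpha>. \<alpha> \<in> ht ` underS r t \<Longrightarrow> \<alpha> < \<beta>"
    using countable_omega1_bounded[OF countable_image[OF countable_less, of ht t]] by blast
  then have "\<forall>s. s \<sqsubset> t \<longrightarrow> ht s < \<beta>" by blast
  then have "\<forall>s. s \<sqsubset> t \<longrightarrow> ht s < ht t"
    unfolding ht_eq[of t] by (rule LeastI[where P = "\<lambda>\<alpha>. \<forall>s. s \<sqsubset> t \<longrightarrow> ht s < \<alpha>"])
  then show ?thesis using \<open>s \<sqsubset> t\<close> by blast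
qed

lemma ht_leI: "(\<And>s. s \<sqsubset> t \<Longrightarrow> ht s < \<alpha>) \<Longrightarrow> ht t \<le> \<alpha>"
  unfolding ht_eq[of t] by (rule Least_le[where P = "\<lambda>\<alpha>. \<forall>s. s \<sqsubset> t \<longrightarrow> ht s < \<alpha>"]) blast

lemma ht_cong: "underS r s = underS r t \<Longrightarrow> ht s = ht t"
  by (simp add: ht_eq[of s] ht_eq[of t])

lemma ht_mono: "s \<sqsubseteq> t \<Longrightarrow> ht s \<le> ht t"
  using ht_less by (cases "s = t") (auto simp: less_iff less_imp_le)

lemma less_iff_ht_less:
  assumes "s \<sqsubseteq> t" "s' \<sqsubseteq> t"
  shows "s \<sqsubset> s' \<longleftrightarrow> ht s < ht s'"
  using le_linear[OF assms(2,1)] ht_less[of s s'] ht_mono[of s' s] by (auto simp: not_le)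

lemma ht_inj:
  assumes "s \<sqsubseteq> t" "s' \<sqsubseteq> t" "ht s = ht s'"
  shows "s = s'"
  using le_linear[OF assms(1,2)] ht_less[of s s'] ht_less[of s' s] assms(3) by (auto simp: less_iff)

text \<open>The first node of height at least \<beta> on the branch has only predecessors of height
  below \<beta>, so its own height cannot exceed \<beta>: branches skip no level.\<close>

lemma ht_surj:
  assumes "t \<in> T" "\<beta> \<le> ht t"
  obtains s where "s \<sqsubseteq> t" "ht s = \<beta>"
proof -
  obtain s where s: "s \<sqsubseteq> t" "\<beta> \<le> ht s" "\<And>u. u \<sqsubset> s \<Longrightarrow> \<not> \<beta> \<le> ht u"
    using minimal_below[where P = "\<lambda>s. \<beta> \<le> ht s", OF assms] by blast
  then have "ht s \<le> \<beta>"
    by (intro ht_leI) (simp add: not_le)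
  then show ?thesis
    using that s by force
qed

text \<open>Well defined for \<open>\<beta> \<le> ht t\<close>: existence comes from
  \<open>ht_surj\<close>, uniqueness from \<open>ht_inj\<close>.\<close>

definition anc :: "'a \<Rightarrow> omega1 \<Rightarrow> 'a" where
  "anc t \<beta> = (THE s. s \<sqsubseteq> t \<and> ht s = \<beta>)"

lemma anc_ht: "s \<sqsubseteq> t \<Longrightarrow> anc t (ht s) = s"
  unfolding anc_def using ht_inj by blast

lemma anc:
  assumes "t \<in> T" "\<beta> \<le> ht t"
  shows "anc t \<beta> \<sqsubseteq> t" "ht (anc t \<beta>) = \<beta>"
  using ht_surj[OF assms] anc_ht by metis+

lemma anc_self: "t \<in> T \<Longrightarrow> anc t (ht t) = t"
  by (simp add: anc_ht le_refl)

lemma anc_le: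
  assumes "s \<sqsubseteq> t" "\<beta> \<le> ht s"
  shows "anc s \<beta> = anc t \<beta>"
  using anc[of s \<beta>] assms le_in le_trans anc_ht by metis

text \<open>Nodes of equal height are pairwise incomparable, so each level is a countable antichain,
  and only countably many levels are involved.\<close>

lemma countable_ht_le: "countable {t \<in> T. ht t \<le> \<alpha>}"
proof -
  have "countable {..\<alpha>}"
    using countable_lessThan_omega1[of \<alpha>] by (simp add: ivl_disj_un(2)[symmetric])
  moreover have "countable {t \<in> T. ht t = \<beta>}" for \<beta>
    using ht_less by (intro countable_antichain) force+
  ultimately have "countable (\<Union>\<beta>\<in>{..\<alpha>}. {t \<in> T. ht t = \<beta>})"
    by blast
  then show ?thesis
    by (rule countable_subset[rotated]) auto
qed

lemma uncountable_ht_unbounded: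
  assumes "A \<subseteq> T" "uncountable A"
  obtains t where "t \<in> A" "\<alpha> < ht t"
proof -
  have "\<not> A \<subseteq> {t \<in> T. ht t \<le> \<alpha>}"
    using countable_ht_le assms(2) countable_subset by blast
  then show ?thesis
    using assms(1) that by force
qed

section \<open>Splitting and accumulation in the tree\<close>

text \<open>Take for \<open>a\<close> and \<open>b\<close> the first nodes on the two branches that
  lie off the other branch. Below either of them are exactly the common nodes, which makes them
  siblings.\<close>

lemma incomparable_split:
  assumes "s \<in> T" "t \<in> T" "\<not> s \<sqsubseteq> t" "\<not> t \<sqsubseteq> s"
  shows "\<exists>a b. a \<sqsubseteq> s \<and> b \<sqsubseteq> t \<and> a \<noteq> b \<and> underS r a = underS r b \<and>
    (\<forall>u. u \<sqsubseteq> s \<longrightarrow> u \<sqsubseteq> t \<longrightarrow> u \<sqsubset> a)"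
proof -
  obtain a where a: "a \<sqsubseteq> s" "\<not> a \<sqsubseteq> t" "\<And>u. u \<sqsubset> a \<Longrightarrow> \<not> \<not> u \<sqsubseteq> t"
    using minimal_below[where P = "\<lambda>s. \<not> s \<sqsubseteq> t", OF assms(1,3)] by blast
  obtain b where b: "b \<sqsubseteq> t" "\<not> b \<sqsubseteq> s" "\<And>u. u \<sqsubset> b \<Longrightarrow> \<not> \<not> u \<sqsubseteq> s"
    using minimal_below[where P = "\<lambda>t. \<not> t \<sqsubseteq> s", OF assms(2,4)] by blast
  have A: "u \<sqsubset> a \<longleftrightarrow> u \<sqsubseteq> s \<and> u \<sqsubseteq> t" for u
    using a le_linear[of a s u] le_trans[of u a s] le_trans[of a u t] by (auto simp: less_iff)
  have B: "u \<sqsubset> b \<longleftrightarrow> u \<sqsubseteq> s \<and> u \<sqsubseteq> t" for u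
    using b le_linear[of b t u] le_trans[of u b t] le_trans[of b u s] by (auto simp: less_iff)
  have "a \<noteq> b" using a b by blast
  moreover have "underS r a = underS r b"
    using A B by (intro set_eqI) simp
  ultimately show ?thesis
    using a(1) b(1) A by (intro exI[of _ a] exI[of _ b]) simp
qed

text \<open>
  The elements of \<open>A\<close> with exactly \<open>n\<close> predecessors in \<open>A\<close> form an antichain, so some
  element of \<open>A\<close> has infinitely many.
\<close>

lemma uncountable_accumulates:
  assumes "A \<subseteq> T" "uncountable A"
  obtains t s where "s \<sqsubset> t" "\<And>v. v \<sqsubset> t \<Longrightarrow> \<exists>a\<in>A. v \<sqsubset> a \<and> a \<sqsubset> t"
proof -
  define N where "N t = A \<inter> underS r t" for t
  have "\<exists>a\<in>A. infinite (N a)"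
  proof (rule ccontr)
    assume fin: "\<not> (\<exists>a\<in>A. infinite (N a))"
    have "countable {a \<in> A. card (N a) = n}" for n
    proof (rule countable_antichain)
      fix a b assume ab: "a \<in> {a \<in> A. card (N a) = n}" "b \<in> {a \<in> A. card (N a) = n}"
      show "\<not> a \<sqsubset> b"
      proof
        assume "a \<sqsubset> b"
        then have "a \<in> N b" "a \<notin> N a"
          using ab by (auto simp: N_def less_iff)
        moreover have "N a \<subseteq> N b"
          unfolding N_def using less_le_trans[of _ a b] \<open>a \<sqsubset> b\<close> less_iff by blast
        ultimately have "N a \<subset> N b" by blast
        then show False
          using psubset_card_mono[of "N b" "N a"] fin ab by auto
      qed
    qed (use assms in auto)
    then have "countable (\<Union>n. {a \<in> A. card (N a) = n})" by blast
    moreover have "A \<subseteq> (\<Union>n. {a \<in> A. card (N a) = n})" by auto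
    ultimately show False
      using assms(2) countable_subset by blast
  qed
  then obtain a where a: "a \<in> A" "infinite (N a)" by blast
  \<comment> \<open>Minimality leaves only finitely many members of \<open>A\<close> below any
    earlier \<open>v\<close>; as infinitely many lie below \<open>t\<close>, some lie strictly
    between.\<close>
  obtain t where t: "t \<sqsubseteq> a" "infinite (N t)" "\<And>u. u \<sqsubset> t \<Longrightarrow> \<not> infinite (N u)"
    using minimal_below[where P = "\<lambda>t. infinite (N t)", OF subsetD[OF assms(1) a(1)] a(2)] by blast
  have step: "\<exists>a\<in>A. v \<sqsubset> a \<and> a \<sqsubset> t" if v: "v \<sqsubset> t" for v
  proof -
    have "finite (insert v (N v))" using t(3) v by simp
    then obtain a where a: "a \<in> N t" "a \<notin> insert v (N v)"
      using t(2) finite_subset[of "N t" "insert v (N v)"] by blast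
    then have "a \<in> A" "a \<sqsubset> t" "\<not> a \<sqsubset> v" "a \<noteq> v" by (simp_all add: N_def)
    then have "v \<sqsubset> a"
      using v le_linear[of v t a] by (simp add: less_iff)
    then show ?thesis using \<open>a \<in> A\<close> \<open>a \<sqsubset> t\<close> by blast
  qed
  have "N t \<noteq> {}" using t(2) by auto
  then obtain s where "s \<sqsubset> t" by (auto simp: N_def)
  then show ?thesis
    using step by (rule that)
qed

text \<open>If the nodes with uncountably many members of \<open>A\<close> above them formed a chain
  \<open>Z\<close>, then \<open>Z\<close> would be countable, and so would the antichain
  \<open>M\<close> of first nodes outside \<open>Z\<close>. Every member of \<open>A\<close> lies in
  \<open>Z\<close>, in \<open>M\<close> or above a member of \<open>M\<close>, and each member of
  \<open>M\<close> has only countably many above it.\<close>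

lemma uncountable_splits:
  assumes "A \<subseteq> T" "uncountable A"
  obtains s s' where "s \<in> T" "s' \<in> T" "\<not> s \<sqsubseteq> s'" "\<not> s' \<sqsubseteq> s"
    "uncountable {t \<in> A. s \<sqsubset> t}" "uncountable {t \<in> A. s' \<sqsubset> t}"
proof -
  define Z where "Z = {s \<in> T. uncountable {t \<in> A. s \<sqsubset> t}}"
  have "\<exists>s\<in>Z. \<exists>s'\<in>Z. \<not> s \<sqsubseteq> s' \<and> \<not> s' \<sqsubseteq> s"
  proof (rule ccontr)
    assume "\<not> ?thesis"
    then have Z: "countable Z"
      by (intro countable_chain) (simp add: Z_def, blast)
    define M where "M = {m \<in> T - Z. \<forall>u. u \<sqsubset> m \<longrightarrow> u \<in> Z}"
    have "\<not> a \<sqsubset> b" if "a \<in> M" "b \<in> M" for a b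
    proof
      assume "a \<sqsubset> b"
      then have "a \<in> Z" using that(2) by (simp add: M_def)
      then show False using that(1) by (simp add: M_def)
    qed
    moreover have "M \<subseteq> T" by (simp add: M_def subset_iff)
    ultimately have "countable M"
      by (intro countable_antichain)
    moreover have "countable {t \<in> A. m \<sqsubset> t}" if "m \<in> M" for m
    proof -
      have "m \<in> T" "m \<notin> Z" using that by (simp_all add: M_def)
      then show ?thesis by (simp add: Z_def)
    qed
    ultimately have "countable (Z \<union> M \<union> (\<Union>m\<in>M. {t \<in> A. m \<sqsubset> t}))"
      by (intro countable_Un Z countable_UN) simp_all
    moreover have "t \<in> Z \<union> M \<union> (\<Union>m\<in>M. {t \<in> A. m \<sqsubset> t})" if t: "t \<in> A" for t
    proof (cases "t \<in> Z")
      case False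
      obtain m where m: "m \<sqsubseteq> t" "m \<notin> Z" "\<forall>u. u \<sqsubset> m \<longrightarrow> \<not> u \<notin> Z"
        using minimal_below[where P = "\<lambda>t. t \<notin> Z", OF subsetD[OF assms(1) t] False] by (elim exE conjE)
      then have "m \<in> M"
        using le_in[OF m(1)] by (simp add: M_def)
      show ?thesis
      proof (cases "m = t")
        case True
        then show ?thesis using \<open>m \<in> M\<close> by simp
      next
        case False
        then have "m \<sqsubset> t" using m(1) by (simp add: less_iff)
        then show ?thesis using \<open>m \<in> M\<close> t by (intro UnI2 UN_I[of m]) simp_all
      qed
    qed simp
    ultimately have "countable A"
      by (rule countable_subset[rotated, OF _ subsetI])
    then show False using assms(2) by simp
  qed
  then obtain s s' where "s \<in> Z" "s' \<in> Z" "\<not> s \<sqsubseteq> s'" "\<not> s' \<sqsubseteq> s" by blast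
  then show ?thesis
    by (intro that[of s s']) (simp_all add: Z_def)
qed

end

section \<open>The surface\<close>

definition shear :: "real \<Rightarrow> real" where
  "shear y = y / (1 - y)"

definition bump :: "omega1 \<Rightarrow> long_ray \<Rightarrow> real" where
  "bump \<beta> l = (if lev l = \<beta> then shear (frac_part l) else 0)"

lemma shear_nonneg: "0 \<le> y \<Longrightarrow> y < 1 \<Longrightarrow> 0 \<le> shear y"
  by (simp add: shear_def)

lemma shear_mono: "0 \<le> x \<Longrightarrow> x \<le> y \<Longrightarrow> y < 1 \<Longrightarrow> shear x \<le> shear y"
  unfolding shear_def by (intro frac_le) auto

lemma shear_0 [simp]: "shear 0 = 0"
  by (simp add: shear_def)

lemma shear_surj:
  assumes "0 \<le> z"
  obtains y where "0 \<le> y" "y < 1" "shear y = z"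
proof
  have "1 - z / (1 + z) = 1 / (1 + z)"
    using assms by (simp add: field_simps)
  then show "shear (z / (1 + z)) = z"
    using assms by (simp add: shear_def)
qed (use assms in simp_all)

text \<open>On [0, \<beta> + 1) the bump is zero up to the start of level \<beta> and then runs
  through the whole half-line, so it is monotone with an interval as image. This covers the start of
  level \<beta> too, even for limit \<beta>.\<close>

lemma continuous_on_bump: "continuous_on {l. lev l \<le> \<beta>} (bump \<beta>)"
proof (rule continuous_on_mono_interval_image)
  show "mono_on {l. lev l \<le> \<beta>} (bump \<beta>)"
  proof (rule mono_onI)
    fix l l' assume l: "l \<in> {l. lev l \<le> \<beta>}" "l' \<in> {l. lev l \<le> \<beta>}" "l \<le> l'"
    show "bump \<beta> l \<le> bump \<beta> l'"
    proof (cases "lev l = \<beta>")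
      case True
      then have "lev l' = \<beta>" "frac_part l \<le> frac_part l'"
        using l by (auto simp: le_long_ray_iff)
      then show ?thesis
        using True shear_mono[of "frac_part l" "frac_part l'"] by (simp add: bump_def)
    next
      case False
      then show ?thesis
        using shear_nonneg[of "frac_part l'"] by (simp add: bump_def)
    qed
  qed
  have "bump \<beta> ` {l. lev l \<le> \<beta>} = {0..}"
  proof (intro equalityI subsetI)
    fix z :: real assume "z \<in> {0..}"
    then obtain y where "0 \<le> y" "y < 1" "shear y = z"
      using shear_surj[of z] by auto
    then show "z \<in> bump \<beta> ` {l. lev l \<le> \<beta>}"
      by (intro image_eqI[of _ _ "lray \<beta> y"]) (simp_all add: bump_def)
  qed (auto simp: bump_def shear_nonneg)
  then show "is_interval (bump \<beta> ` {l. lev l \<le> \<beta>})"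
    by (simp add: is_interval_1)
qed

definition shift :: "omega1 \<Rightarrow> real \<Rightarrow> real \<times> long_ray \<Rightarrow> real \<times> long_ray" where
  "shift \<beta> c = (\<lambda>(u, l). (u + c * bump \<beta> l, l))"

lemma open_lev_le: "open {l. lev l \<le> \<beta>}"
  by (simp add: lev_le_eq)

lemma continuous_on_shift: "continuous_on (UNIV \<times> {l. lev l \<le> \<beta>}) (shift \<beta> c)"
proof -
  have "continuous_on (UNIV \<times> {l. lev l \<le> \<beta>}) (\<lambda>z :: real \<times> long_ray. bump \<beta> (snd z))"
    by (rule continuous_on_compose2[OF continuous_on_bump]) (auto intro: continuous_intros)
  then show ?thesis
    unfolding shift_def case_prod_beta by (intro continuous_intros)
qed

context suslin
begin

text \<open>
  A node is a set of predecessors, so siblings in the tree leave from the same node in directions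
  numbered by \<open>sib\<close>; a point is stored as the code of its node and two coordinates.
\<close>

definition code :: "'a set \<Rightarrow> omega1" where
  "code = (SOME c. inj_on c (underS r ` T))"

definition sib :: "'a \<Rightarrow> real" where
  "sib t = real (to_nat_on {s \<in> T. underS r s = underS r t} t)"

text \<open>The second entry absorbs the shear: siblings \<open>a\<close> and \<open>b\<close> give
  the same point at fraction \<open>y\<close> exactly when their first coordinates differ by
  \<open>(sib a - sib b) * shear y\<close>. The level is determined by the coded predecessor
  set.\<close>

definition chart :: "'a \<Rightarrow> real \<times> long_ray \<Rightarrow> omega1 \<times> real \<times> real" where
  "chart t = (\<lambda>(u, l). (code (underS r (anc t (lev l))),
     u + sib (anc t (lev l)) * shear (frac_part l), frac_part l))"

definition chart_dom :: "'a \<Rightarrow> (real \<times> long_ray) set" where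
  "chart_dom t = UNIV \<times> {l. lev l \<le> ht t}"

definition points :: "(omega1 \<times> real \<times> real) set" where
  "points = (\<Union>t\<in>T. chart t ` chart_dom t)"

text \<open>The finest topology making all charts continuous. Each \<open>chart_dom t\<close> is
  open in the product, so plain \<open>open\<close> expresses openness relative to it.\<close>

definition X :: "(omega1 \<times> real \<times> real) topology" where
  "X = topology (\<lambda>W. W \<subseteq> points \<and> (\<forall>t\<in>T. open (chart_dom t \<inter> chart t -` W)))"

lemma mem_dom [simp]: "(u, l) \<in> chart_dom t \<longleftrightarrow> lev l \<le> ht t"
  by (simp add: chart_dom_def)

lemma open_dom: "open (chart_dom t)"
  unfolding chart_dom_def by (intro open_Times open_lev_le open_UNIV)

text \<open>An injection of \<open>T\<close> into \<open>omega1\<close>, applied to a chosen node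
  with the given predecessor set, witnesses the choice made in \<open>code\<close>.\<close>

lemma inj_code: "inj_on code (underS r ` T)"
proof -
  obtain f :: "'a \<Rightarrow> omega1" where f: "inj_on f T"
    using ex_inj_omega1 by blast
  have "inv_into T (underS r) ` underS r ` T \<subseteq> T"
    using inv_into_into[of _ "underS r" T] by blast
  then have "inj_on (f \<circ> inv_into T (underS r)) (underS r ` T)"
    by (rule comp_inj_on[OF inj_on_inv_into[OF subset_refl] inj_on_subset[OF f]])
  then show ?thesis
    unfolding code_def by (rule someI[of "\<lambda>c. inj_on c (underS r ` T)"])
qed

text \<open>Nodes with the same predecessors are pairwise incomparable, hence countable in number,
  so \<open>to_nat_on\<close> enumerates them without repetition.\<close>

lemma sib_inj:
  assumes "s \<in> T" "t \<in> T" "underS r s = underS r t" "sib s = sib t"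
  shows "s = t"
proof -
  define B where "B = {u \<in> T. underS r u = underS r t}"
  have "\<not> a \<sqsubset> b" if "a \<in> B" "b \<in> B" for a b
  proof
    assume "a \<sqsubset> b"
    then have "a \<in> underS r a" using that by (simp add: B_def)
    then show False by (simp add: less_iff)
  qed
  moreover have "B \<subseteq> T" by (simp add: B_def subset_iff)
  ultimately have "countable B"
    by (intro countable_antichain)
  moreover have "to_nat_on B s = to_nat_on B t"
    using assms by (simp add: sib_def B_def)
  moreover have "s \<in> B" "t \<in> B"
    using assms by (simp_all add: B_def)
  ultimately show ?thesis
    by (metis inj_onD inj_on_to_nat_on)
qed

text \<open>Equal codes give equal predecessor sets, and these determine the height and hence the
  level; so \<open>l = l'\<close> although only the fraction is stored.\<close>

lemma chart_eq_iff:
  assumes "t \<in> T" "t' \<in> T" "lev l \<le> ht t" "lev l' \<le> ht t'"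
  shows "chart t (u, l) = chart t' (u', l') \<longleftrightarrow>
    l = l' \<and> underS r (anc t (lev l)) = underS r (anc t' (lev l)) \<and>
    u + sib (anc t (lev l)) * shear (frac_part l) = u' + sib (anc t' (lev l)) * shear (frac_part l)"
    (is "?L \<longleftrightarrow> ?R")
proof
  assume L: ?L
  have T: "anc t (lev l) \<in> T" "anc t' (lev l') \<in> T"
    using anc(1)[of t "lev l"] anc(1)[of t' "lev l'"] assms le_in by simp_all
  have U: "underS r (anc t (lev l)) = underS r (anc t' (lev l'))"
    by (rule inj_onD[OF inj_code]) (use L T in \<open>simp_all add: chart_def\<close>)
  then have "lev l = lev l'"
    using ht_cong[OF U] anc(2) assms by simp
  moreover have "frac_part l = frac_part l'"
    using L by (simp add: chart_def)
  ultimately have "l = l'"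
    by (metis lray_lev_frac_part)
  then show ?R
    using L U by (simp add: chart_def)
next
  assume ?R
  then show ?L
    by (elim conjE, hypsubst) (simp add: chart_def)
qed

lemma chart_anc:
  assumes "s \<sqsubseteq> t" "lev l \<le> ht s"
  shows "chart s (u, l) = chart t (u, l)"
  using anc_le[OF assms] by (simp add: chart_def)

lemma inj_chart: "t \<in> T \<Longrightarrow> inj_on (chart t) (chart_dom t)"
  by (rule inj_onI) (auto simp: chart_dom_def chart_eq_iff[of t t])

text \<open>
  \<open>\<beta>\<close> is the level at which the branches of \<open>t\<close> and \<open>t'\<close> part; along comparable branches
  the shift is trivial.
\<close>

lemma chart_overlap:
  assumes t: "t \<in> T" "t' \<in> T"
  shows "\<exists>\<beta> c. \<beta> \<le> ht t \<and> \<beta> \<le> ht t' \<and> (c = 0 \<longrightarrow> \<beta> = ht t \<or> \<beta> = ht t') \<and>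
    (\<forall>u l u' l'. lev l \<le> ht t \<longrightarrow> lev l' \<le> ht t' \<longrightarrow>
      (chart t (u, l) = chart t' (u', l') \<longleftrightarrow> lev l \<le> \<beta> \<and> (u', l') = shift \<beta> c (u, l)))"
proof (cases "t \<sqsubseteq> t' \<or> t' \<sqsubseteq> t")
  case True
  define \<beta> where "\<beta> = min (ht t) (ht t')"
  show ?thesis
  proof (intro exI[of _ \<beta>] exI[of _ "0 :: real"] conjI allI impI)
    show "\<beta> \<le> ht t" "\<beta> \<le> ht t'" "\<beta> = ht t \<or> \<beta> = ht t'"
      by (auto simp: \<beta>_def min_def)
    fix u l u' l'
    assume l: "lev l \<le> ht t" "lev l' \<le> ht t'"
    have "anc t (lev l) = anc t' (lev l)" if "lev l \<le> ht t'"
      using True anc_le[of t t' "lev l"] anc_le[of t' t "lev l"] l(1) that by (elim disjE) simp_all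
    then show "chart t (u, l) = chart t' (u', l') \<longleftrightarrow> lev l \<le> \<beta> \<and> (u', l') = shift \<beta> 0 (u, l)"
      using chart_eq_iff[OF t l] l by (cases "l = l'") (auto simp: shift_def \<beta>_def)
  qed
next
  case False
  then have "\<not> t \<sqsubseteq> t'" "\<not> t' \<sqsubseteq> t" by simp_all
  then obtain a b where ab: "a \<sqsubseteq> t" "b \<sqsubseteq> t'" "a \<noteq> b" "underS r a = underS r b"
      and common: "\<forall>u. u \<sqsubseteq> t \<longrightarrow> u \<sqsubseteq> t' \<longrightarrow> u \<sqsubset> a"
    using incomparable_split[OF t] by (elim meta_impE exE conjE)
  have hab: "ht a = ht b" using ab(4) by (rule ht_cong)
  have abT: "a \<in> T" "b \<in> T" using ab le_in by blast+
  show ?thesis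
  proof (intro exI[of _ "ht a"] exI[of _ "sib a - sib b"] conjI allI impI)
    show "ht a \<le> ht t" "ht a \<le> ht t'"
      using ht_mono[OF ab(1)] ht_mono[OF ab(2)] by (simp_all add: hab)
    \<comment> \<open>Vacuous, since distinct siblings carry distinct numbers. This is what forces a
      nonzero shift between parting branches when points are separated.\<close>
    show "ht a = ht t \<or> ht a = ht t'" if "sib a - sib b = 0"
      using sib_inj[OF abT ab(4)] that ab(3) by simp
    fix u l u' l'
    assume l: "lev l \<le> ht t" "lev l' \<le> ht t'"
    show "chart t (u, l) = chart t' (u', l') \<longleftrightarrow>
      lev l \<le> ht a \<and> (u', l') = shift (ht a) (sib a - sib b) (u, l)"
    proof (cases "l = l'")
      case True
      define e where "e = anc t (lev l)"
      define e' where "e' = anc t' (lev l)"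
      have e: "e \<sqsubseteq> t" "ht e = lev l"
        unfolding e_def using anc[OF t(1) l(1)] by simp_all
      have e': "e' \<sqsubseteq> t'" "ht e' = lev l"
        unfolding e'_def using anc[OF t(2) l(2)] True by simp_all
      have eq: "chart t (u, l) = chart t' (u', l') \<longleftrightarrow> underS r e = underS r e' \<and>
          u + sib e * shear (frac_part l) = u' + sib e' * shear (frac_part l)"
        using chart_eq_iff[OF t l] True by (simp add: e_def e'_def)
      \<comment> \<open>Below the split the branches run through the same nodes. At the split they
        use the siblings \<open>a\<close> and \<open>b\<close>, whose shears differ by the stated
        shift. Beyond it \<open>a\<close> lies below only one of the two nodes, so no point is
        shared.\<close>
      consider "lev l < ht a" | "lev l = ht a" | "ht a < lev l" by fastforce
      then show ?thesis
      proof cases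
        case 1
        then have "e \<sqsubset> b"
          using less_iff_ht_less[OF e(1) ab(1)] e(2) ab(4) by simp
        then have "e \<sqsubseteq> t'"
          using less_le_trans[OF _ ab(2)] by (simp add: less_iff)
        then have "e = e'"
          using ht_inj[OF _ e'(1)] e(2) e'(2) by simp
        then show ?thesis
          using eq 1 True by (auto simp: shift_def bump_def)
      next
        case 2
        then have "e = a" "e' = b"
          using ht_inj[OF e(1) ab(1)] ht_inj[OF e'(1) ab(2)] e(2) e'(2) hab by simp_all
        then show ?thesis
          using eq 2 True ab(4) by (auto simp: shift_def bump_def algebra_simps)
      next
        case 3
        then have "a \<sqsubset> e"
          using less_iff_ht_less[OF ab(1) e(1)] e(2) by simp
        moreover have "\<not> a \<sqsubset> e'"
        proof
          assume "a \<sqsubset> e'"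
          then have "a \<sqsubseteq> t'"
            using less_le_trans[OF _ e'(1)] by (simp add: less_iff)
          then show False
            using common[rule_format, OF ab(1)] by (simp add: less_iff)
        qed
        ultimately show ?thesis
          using eq 3 by auto
      qed
    next
      case False
      then show ?thesis
        using chart_eq_iff[OF t l] by (simp add: shift_def)
    qed
  qed
qed

section \<open>The glued topology and its charts\<close>

lemma openin_X: "openin X W \<longleftrightarrow> W \<subseteq> points \<and> (\<forall>t\<in>T. open (chart_dom t \<inter> chart t -` W))"
proof -
  have "istopology (\<lambda>W. W \<subseteq> points \<and> (\<forall>t\<in>T. open (chart_dom t \<inter> chart t -` W)))"
    unfolding istopology_def
  proof (intro conjI allI impI ballI)
    fix S U t
    assume S: "S \<subseteq> points \<and> (\<forall>t\<in>T. open (chart_dom t \<inter> chart t -` S))"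
      and U: "U \<subseteq> points \<and> (\<forall>t\<in>T. open (chart_dom t \<inter> chart t -` U))"
    show "S \<inter> U \<subseteq> points" using S by blast
    assume "t \<in> T"
    then have "open ((chart_dom t \<inter> chart t -` S) \<inter> (chart_dom t \<inter> chart t -` U))"
      using S U by (intro open_Int[of "chart_dom t \<inter> chart t -` S" "chart_dom t \<inter> chart t -` U"]) simp_all
    moreover have "(chart_dom t \<inter> chart t -` S) \<inter> (chart_dom t \<inter> chart t -` U) = chart_dom t \<inter> chart t -` (S \<inter> U)"
      by auto
    ultimately show "open (chart_dom t \<inter> chart t -` (S \<inter> U))" by simp
  next
    fix \<K> t
    assume K: "\<forall>S\<in>\<K>. S \<subseteq> points \<and> (\<forall>t\<in>T. open (chart_dom t \<inter> chart t -` S))"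
    then show "\<Union>\<K> \<subseteq> points" by blast
    assume "t \<in> T"
    then have "open (\<Union>S\<in>\<K>. chart_dom t \<inter> chart t -` S)"
      using K by (intro open_UN) simp
    moreover have "(\<Union>S\<in>\<K>. chart_dom t \<inter> chart t -` S) = chart_dom t \<inter> chart t -` \<Union>\<K>"
      by auto
    ultimately show "open (chart_dom t \<inter> chart t -` \<Union>\<K>)" by simp
  qed
  then show ?thesis
    by (simp add: X_def topology_inverse')
qed

lemma chart_in_points: "t \<in> T \<Longrightarrow> z \<in> chart_dom t \<Longrightarrow> chart t z \<in> points"
  by (auto simp: points_def)

lemma topspace_X [simp]: "topspace X = points"
proof (rule antisym)
  show "topspace X \<subseteq> points"
    using openin_topspace[of X] unfolding openin_X by blast
  have "chart_dom t \<inter> chart t -` points = chart_dom t" if "t \<in> T" for t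
    using chart_in_points[OF that] by blast
  then have "openin X points"
    using open_dom by (simp add: openin_X)
  then show "points \<subseteq> topspace X"
    by (rule openin_subset)
qed

text \<open>Seen in another chart, the image is the preimage of \<open>V\<close> under the
  transition \<open>shift\<close>, which is continuous on the open overlap.\<close>

lemma openin_chart_image:
  assumes t: "t \<in> T" and V: "open V" "V \<subseteq> chart_dom t"
  shows "openin X (chart t ` V)"
  unfolding openin_X
proof (intro conjI ballI)
  show "chart t ` V \<subseteq> points"
    using chart_in_points[OF t] V(2) by blast
  fix t' assume t': "t' \<in> T"
  obtain \<beta> c where \<beta>: "\<beta> \<le> ht t'"
    and eq: "\<forall>u l u' l'. lev l \<le> ht t' \<longrightarrow> lev l' \<le> ht t \<longrightarrow>
      (chart t' (u, l) = chart t (u', l') \<longleftrightarrow> lev l \<le> \<beta> \<and> (u', l') = shift \<beta> c (u, l))"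
    using chart_overlap[OF t' t] by (elim exE conjE)
  have "chart_dom t' \<inter> chart t' -` chart t ` V = (UNIV \<times> {l. lev l \<le> \<beta>}) \<inter> shift \<beta> c -` V"
  proof (intro set_eqI iffI)
    fix z assume z: "z \<in> chart_dom t' \<inter> chart t' -` chart t ` V"
    then obtain v where v: "v \<in> V" "chart t' z = chart t v" by auto
    obtain u l where ul: "z = (u, l)" by fastforce
    obtain u' l' where ul': "v = (u', l')" by fastforce
    have "lev l \<le> ht t'" "lev l' \<le> ht t"
      using z v(1) V(2) ul ul' by auto
    then show "z \<in> (UNIV \<times> {l. lev l \<le> \<beta>}) \<inter> shift \<beta> c -` V"
      using eq[rule_format, of l l' u u'] v ul ul' by simp
  next
    fix z assume z: "z \<in> (UNIV \<times> {l. lev l \<le> \<beta>}) \<inter> shift \<beta> c -` V"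
    obtain u l where ul: "z = (u, l)" by fastforce
    obtain u' l' where ul': "shift \<beta> c z = (u', l')" by fastforce
    have v: "(u', l') \<in> V" "lev l \<le> \<beta>" using z ul ul' by auto
    then have "lev l \<le> ht t'" "lev l' \<le> ht t"
      using \<beta> V(2) by auto
    then have "chart t' z = chart t (u', l')"
      using eq[rule_format, of l l' u u'] ul ul' v(2) by simp
    then show "z \<in> chart_dom t' \<inter> chart t' -` chart t ` V"
      using v(1) ul \<open>lev l \<le> ht t'\<close> by auto
  qed
  moreover have "open ((UNIV \<times> {l. lev l \<le> \<beta>}) \<inter> shift \<beta> c -` V)"
    by (intro continuous_open_preimage continuous_on_shift open_Times open_UNIV open_lev_le V(1))
  ultimately show "open (chart_dom t' \<inter> chart t' -` chart t ` V)" by simp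
qed

lemma embedding_map_chart:
  assumes "t \<in> T"
  shows "embedding_map (top_of_set (chart_dom t)) X (chart t)"
proof (rule injective_open_imp_embedding_map)
  show "continuous_map (top_of_set (chart_dom t)) X (chart t)"
    unfolding continuous_map_def
  proof (intro conjI allI impI)
    show "chart t \<in> topspace (top_of_set (chart_dom t)) \<rightarrow> topspace X"
      using chart_in_points[OF assms] by simp
    fix W assume "openin X W"
    then have "open (chart_dom t \<inter> chart t -` W)"
      using assms by (simp add: openin_X)
    moreover have "{z \<in> topspace (top_of_set (chart_dom t)). chart t z \<in> W} = chart_dom t \<inter> chart t -` W"
      by auto
    ultimately show "openin (top_of_set (chart_dom t)) {z \<in> topspace (top_of_set (chart_dom t)). chart t z \<in> W}"
      unfolding openin_open_eq[OF open_dom] by (metis Int_lower1)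
  qed
  show "open_map (top_of_set (chart_dom t)) X (chart t)"
    unfolding open_map_def openin_open_eq[OF open_dom]
    using openin_chart_image[OF assms] by (intro allI impI) simp
  show "inj_on (chart t) (topspace (top_of_set (chart_dom t)))"
    using inj_chart[OF assms] by simp
qed

lemma continuous_map_X_I:
  fixes f :: "omega1 \<times> real \<times> real \<Rightarrow> 'b :: topological_space"
  assumes "\<And>t. t \<in> T \<Longrightarrow> continuous_on (chart_dom t) (\<lambda>z. f (chart t z))"
  shows "continuous_map X euclidean f"
  unfolding continuous_map_def
proof (intro conjI allI impI)
  fix V :: "'b set" assume "openin euclidean V"
  then have V: "open V" by simp
  have "open (chart_dom t \<inter> chart t -` {p \<in> points. f p \<in> V})" if "t \<in> T" for t
  proof -
    have "open (chart_dom t \<inter> (\<lambda>z. f (chart t z)) -` V)"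
      by (rule continuous_open_preimage[OF assms[OF that] open_dom V])
    moreover have "chart_dom t \<inter> (\<lambda>z. f (chart t z)) -` V = chart_dom t \<inter> chart t -` {p \<in> points. f p \<in> V}"
      using chart_in_points[OF that] by auto
    ultimately show ?thesis by simp
  qed
  then show "openin X {p \<in> topspace X. f p \<in> V}"
    by (simp add: openin_X)
qed simp

text \<open>Straightening the second factor turns each strip into a closed half-plane, the model for
  the neighbourhoods of all points.\<close>

lemma chart_dom_homeomorphic_space:
  "top_of_set (chart_dom t) homeomorphic_space top_of_set ((UNIV :: real set) \<times> {0::real..})"
proof -
  obtain g k where gk: "homeomorphism {l. lev l \<le> ht t} {0::real..} g k"
    using long_ray_initial_segment_homeomorphic[of "ht t"] by (auto simp: homeomorphic_def)
  have g: "continuous_on {l. lev l \<le> ht t} g" "g ` {l. lev l \<le> ht t} = {0..}"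
      "\<And>l. lev l \<le> ht t \<Longrightarrow> k (g l) = l"
    and k: "continuous_on {0..} k" "k ` {0..} = {l. lev l \<le> ht t}"
      "\<And>z. 0 \<le> z \<Longrightarrow> g (k z) = z"
    using gk by (simp_all add: homeomorphism_def)
  have "homeomorphic_maps (top_of_set (chart_dom t)) (top_of_set ((UNIV :: real set) \<times> {0::real..}))
      (\<lambda>z. (fst z, g (snd z))) (\<lambda>z. (fst z, k (snd z)))"
    unfolding homeomorphic_maps_def continuous_map_in_subtopology
  proof (intro conjI ballI)
    have "continuous_on (chart_dom t) (\<lambda>z. g (snd z))"
      by (rule continuous_on_compose2[OF g(1)]) (auto simp: chart_dom_def intro: continuous_intros)
    then show "continuous_map (top_of_set (chart_dom t)) euclidean (\<lambda>z. (fst z, g (snd z)))"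
      unfolding continuous_map_iff_continuous by (intro continuous_intros)
    have "continuous_on (UNIV \<times> {0..}) (\<lambda>z :: real \<times> real. k (snd z))"
      by (rule continuous_on_compose2[OF k(1)]) (auto intro: continuous_intros)
    then show "continuous_map (top_of_set ((UNIV :: real set) \<times> {0::real..})) euclidean
        (\<lambda>z. (fst z, k (snd z)))"
      unfolding continuous_map_iff_continuous by (intro continuous_intros)
    have "0 \<le> g l" if "lev l \<le> ht t" for l
      using g(2) that by blast
    then show "(\<lambda>z. (fst z, g (snd z))) \<in> topspace (top_of_set (chart_dom t)) \<rightarrow> (UNIV \<times> {0..})"
      by (auto simp: chart_dom_def)
    have "lev (k z) \<le> ht t" if "0 \<le> z" for z
      using k(2) that by blast
    then show "(\<lambda>z. (fst z, k (snd z))) \<in> topspace (top_of_set ((UNIV :: real set) \<times> {0::real..})) \<rightarrow> chart_dom t"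
      by auto
  qed (auto simp: chart_dom_def g(3) k(3))
  then show ?thesis
    by (auto simp: homeomorphic_space_def)
qed

section \<open>Patches, connectedness and separation\<close>

definition patch :: "'a \<Rightarrow> (omega1 \<times> real \<times> real) set" where
  "patch t = chart t ` chart_dom t"

lemma openin_patch: "t \<in> T \<Longrightarrow> openin X (patch t)"
  unfolding patch_def using openin_chart_image open_dom by blast

lemma patch_homeomorphic_space:
  assumes "t \<in> T"
  shows "subtopology X (patch t) homeomorphic_space top_of_set ((UNIV :: real set) \<times> {0::real..})"
proof -
  have "top_of_set (chart_dom t) homeomorphic_space subtopology X (patch t)"
    using embedding_map_imp_homeomorphic_space[OF embedding_map_chart[OF assms]]
    by (simp add: patch_def)
  then show ?thesis
    using chart_dom_homeomorphic_space homeomorphic_space_sym homeomorphic_space_trans by blast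
qed

lemma Lindelof_patch: "t \<in> T \<Longrightarrow> Lindelof_space (subtopology X (patch t))"
proof -
  assume "t \<in> T"
  then have "top_of_set ((UNIV :: real set) \<times> {0::real..}) homeomorphic_space subtopology X (patch t)"
    using patch_homeomorphic_space homeomorphic_space_sym by blast
  then obtain f where "homeomorphic_map (top_of_set ((UNIV :: real set) \<times> {0::real..})) (subtopology X (patch t)) f"
    using homeomorphic_space by blast
  then show ?thesis
    by (intro Lindelof_space_continuous_map_image[OF Lindelof_space_top_of_set])
      (auto simp: homeomorphic_eq_everything_map)
qed

lemma connected_patch: "t \<in> T \<Longrightarrow> connectedin X (patch t)"
proof -
  assume t: "t \<in> T"
  have "connected_space (top_of_set ((UNIV :: real set) \<times> {0::real..}))"
    by (simp add: connected_space_subtopology connected_Times flip: connectedin_def)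
  then have "connected_space (subtopology X (patch t))"
    using homeomorphic_connected_space[OF patch_homeomorphic_space[OF t]] by blast
  moreover have "patch t \<subseteq> topspace X"
    using openin_patch[OF t] by (rule openin_subset)
  ultimately show ?thesis
    by (simp add: connectedin_def)
qed

lemma points_eq: "points = \<Union>(patch ` T)"
  by (auto simp: points_def patch_def)

text \<open>All patches share a point: at the least level every node has the empty predecessor set,
  and at fraction 0 the shear vanishes, so even different roots are identified there.\<close>

lemma connected_X: "connected_space X"
proof -
  define \<alpha> :: omega1 where "\<alpha> = (LEAST \<alpha>. True)"
  have min: "\<alpha> \<le> \<beta>" for \<beta>
    unfolding \<alpha>_def by (rule Least_le) simp
  obtain t\<^sub>0 where t0: "t\<^sub>0 \<in> T"
    using uncountable_T by fastforce
  have "chart t\<^sub>0 (0, lray \<alpha> 0) \<in> patch t" if "t \<in> T" for t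
  proof -
    have "underS r (anc t' \<alpha>) = {}" if "t' \<in> T" for t'
    proof -
      have "ht (anc t' \<alpha>) = \<alpha>"
        using anc(2)[OF that min] .
      then have "\<not> u \<sqsubset> anc t' \<alpha>" for u
        using ht_less[of u "anc t' \<alpha>"] min[of "ht u"] by auto
      then show ?thesis by blast
    qed
    then have "chart t\<^sub>0 (0, lray \<alpha> 0) = chart t (0, lray \<alpha> 0)"
      using t0 that by (simp add: chart_def)
    then show ?thesis
      unfolding patch_def using min by (intro image_eqI[of _ _ "(0, lray \<alpha> 0)"]) simp_all
  qed
  then have "\<Inter>(patch ` T) \<noteq> {}" by blast
  then have "connectedin X points"
    unfolding points_eq by (intro connectedin_Union) (use connected_patch in auto)
  then show ?thesis
    by (metis connectedin_topspace topspace_X)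
qed

text \<open>Points in a common patch are separated inside it. Otherwise both lie beyond the level
  \<beta> at which their branches part; the regions above a height close enough to the end of that
  level are then pushed apart by the shear.\<close>

lemma Hausdorff_X: "Hausdorff_space X"
  unfolding Hausdorff_space_def
proof (intro allI impI)
  fix p q assume pq: "p \<in> topspace X \<and> q \<in> topspace X \<and> p \<noteq> q"
  have same: "\<exists>U V. openin X U \<and> openin X V \<and> p \<in> U \<and> q \<in> V \<and> disjnt U V"
    if t: "t \<in> T" and pq': "p \<in> patch t" "q \<in> patch t" for t
  proof -
    obtain a b where ab: "a \<in> chart_dom t" "p = chart t a" "b \<in> chart_dom t" "q = chart t b"
      using pq' unfolding patch_def by blast
    then have "a \<noteq> b" using pq by auto
    from hausdorff[OF this] obtain U V where UV: "open U" "open V" "a \<in> U" "b \<in> V" "U \<inter> V = {}"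
      by (elim exE conjE)
    have "openin X (chart t ` (U \<inter> chart_dom t))" "openin X (chart t ` (V \<inter> chart_dom t))"
      by (intro openin_chart_image t open_Int open_dom UV Int_lower2)+
    moreover have "disjnt (chart t ` (U \<inter> chart_dom t)) (chart t ` (V \<inter> chart_dom t))"
      unfolding disjnt_def
      using UV(5) by (subst inj_on_image_Int[OF inj_chart[OF t], symmetric]) auto
    moreover have "p \<in> chart t ` (U \<inter> chart_dom t)" "q \<in> chart t ` (V \<inter> chart_dom t)"
      using ab UV(3,4) by simp_all
    ultimately show ?thesis by blast
  qed
  obtain t u l where p: "t \<in> T" "lev l \<le> ht t" "p = chart t (u, l)"
    using pq by (auto simp: points_def)
  obtain t' u' l' where q: "t' \<in> T" "lev l' \<le> ht t'" "q = chart t' (u', l')"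
    using pq by (auto simp: points_def)
  obtain \<beta> c where \<beta>: "\<beta> \<le> ht t" "\<beta> \<le> ht t'" "c = 0 \<longrightarrow> \<beta> = ht t \<or> \<beta> = ht t'"
    and eq: "\<forall>u l u' l'. lev l \<le> ht t \<longrightarrow> lev l' \<le> ht t' \<longrightarrow>
      (chart t (u, l) = chart t' (u', l') \<longleftrightarrow> lev l \<le> \<beta> \<and> (u', l') = shift \<beta> c (u, l))"
    using chart_overlap[OF p(1) q(1)] by (elim exE conjE)
  show "\<exists>U V. openin X U \<and> openin X V \<and> p \<in> U \<and> q \<in> V \<and> disjnt U V"
  proof (cases "p \<in> patch t' \<or> q \<in> patch t")
    case True
    have "p \<in> patch t" "q \<in> patch t'"
      using p q by (auto simp: patch_def)
    then show ?thesis
      using True same[OF p(1)] same[OF q(1)] by blast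
  next
    case False
    have l: "\<beta> < lev l"
    proof (rule ccontr)
      assume le: "\<not> \<beta> < lev l"
      obtain v m where vm: "shift \<beta> c (u, l) = (v, m)" by fastforce
      then have "m = l" by (simp add: shift_def)
      then have "p = chart t' (v, m)" "lev m \<le> ht t'"
        using le p \<beta>(2) vm eq[rule_format, of l m u v] by auto
      then show False
        using False by (auto simp: patch_def)
    qed
    have l': "\<beta> < lev l'"
    proof (rule ccontr)
      assume le: "\<not> \<beta> < lev l'"
      then have "lev l' \<le> ht t"
        using \<beta>(1) by simp
      moreover from this have "q = chart t (u' - c * bump \<beta> l', l')"
        using le q eq[rule_format, of l' l' "u' - c * bump \<beta> l'" u'] by (simp add: shift_def not_less)
      ultimately have "q = chart t (u' - c * bump \<beta> l', l')" "lev l' \<le> ht t" by simp_all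
      then show False
        using False by (auto simp: patch_def)
    qed
    \<comment> \<open>With \<open>c = 0\<close> one of the charts would end at level \<beta>, yet
      both points lie strictly beyond it.\<close>
    have "c \<noteq> 0"
      using \<beta>(3) l l' p(2) q(2) by auto
    \<comment> \<open>A number within 1 of \<open>u\<close> and one within 1 of \<open>u'\<close>
      differ by less than \<open>\<bar>u - u'\<bar> + 2\<close>; once the shear reaches
      \<open>K\<close>, the shift is at least that large.\<close>
    define K where "K = (\<bar>u - u'\<bar> + 2) / \<bar>c\<bar>"
    have "0 \<le> K" by (simp add: K_def)
    then obtain y where y: "0 \<le> y" "y < 1" "shear y = K"
      using shear_surj by blast
    define V where "V = chart_dom t \<inter> ({u - 1<..<u + 1} \<times> {lray \<beta> y<..})"
    define V' where "V' = chart_dom t' \<inter> ({u' - 1<..<u' + 1} \<times> {lray \<beta> y<..})"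
    have "openin X (chart t ` V)" "openin X (chart t' ` V')"
      unfolding V_def V'_def
      by (intro openin_chart_image p(1) q(1) open_Int open_dom open_Times open_greaterThan
          open_greaterThanLessThan Int_lower1)+
    moreover have "p \<in> chart t ` V" "q \<in> chart t' ` V'"
      using l l' p q y by (auto simp: V_def V'_def less_long_ray_iff)
    moreover have "chart t v \<noteq> chart t' v'" if v: "v \<in> V" "v' \<in> V'" for v v'
    proof
      assume ch: "chart t v = chart t' v'"
      obtain x m where xm: "v = (x, m)" by fastforce
      obtain x' m' where xm': "v' = (x', m')" by fastforce
      have *: "lev m \<le> \<beta> \<and> (x', m') = shift \<beta> c (x, m)"
        using ch v xm xm' eq[rule_format, of m m' x x'] by (auto simp: V_def V'_def)
      have "lray \<beta> y < m" using v(1) xm by (simp add: V_def)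
      then have m: "lev m = \<beta>" "y < frac_part m"
        using * y by (auto simp: less_long_ray_iff)
      then have "K \<le> shear (frac_part m)"
        using shear_mono[of y "frac_part m"] y by simp
      then have "\<bar>c\<bar> * K \<le> \<bar>c\<bar> * shear (frac_part m)"
        by (intro mult_left_mono) simp_all
      also have "\<dots> = \<bar>c * shear (frac_part m)\<bar>"
        using shear_nonneg[of "frac_part m"] by (simp add: abs_mult)
      also have "\<dots> = \<bar>x' - x\<bar>"
        using * m by (simp add: shift_def bump_def)
      also have "\<dots> < \<bar>u - u'\<bar> + 2"
        using v xm xm' by (auto simp: V_def V'_def)
      finally show False
        using \<open>c \<noteq> 0\<close> by (simp add: K_def)
    qed
    ultimately show ?thesis
      unfolding disjnt_iff by blast
  qed
qed

lemma surface_X: "surface X"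
  unfolding surface_def
proof (intro conjI ballI connected_X Hausdorff_X)
  fix p assume "p \<in> topspace X"
  then obtain t where t: "t \<in> T" "p \<in> patch t"
    by (auto simp: points_eq)
  then show "\<exists>N\<subseteq>topspace X. p \<in> X interior_of N \<and>
      (subtopology X N homeomorphic_space (euclidean :: (real \<times> real) topology) \<or>
       subtopology X N homeomorphic_space top_of_set ((UNIV :: real set) \<times> {0::real..}))"
    using openin_patch[OF t(1)] patch_homeomorphic_space[OF t(1)]
    by (intro exI[of _ "patch t"]) (simp add: interior_of_openin openin_subset flip: topspace_X)
qed

section \<open>Heights, compactness and directions\<close>

text \<open>Siblings share the points of their common level, so the choice among them is arbitrary;
  only the predecessor set of the tip, and with it the height, is determined by
  \<open>p\<close>.\<close>

definition tip :: "omega1 \<times> real \<times> real \<Rightarrow> 'a" where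
  "tip p = (SOME t. t \<in> T \<and> (\<exists>u l. lev l = ht t \<and> p = chart t (u, l)))"

definition height :: "omega1 \<times> real \<times> real \<Rightarrow> long_ray" where
  "height p = lray (ht (tip p)) (snd (snd p))"

definition cover :: "omega1 \<Rightarrow> (omega1 \<times> real \<times> real) set" where
  "cover \<alpha> = {p \<in> points. lev (height p) < \<alpha>}"

lemma tip:
  assumes "p \<in> points"
  shows "tip p \<in> T" "\<exists>u l. lev l = ht (tip p) \<and> p = chart (tip p) (u, l)"
proof -
  obtain t u l where t: "t \<in> T" "lev l \<le> ht t" "p = chart t (u, l)"
    using assms by (auto simp: points_def)
  define s where "s = anc t (lev l)"
  have s: "s \<sqsubseteq> t" "ht s = lev l"
    using anc[OF t(1,2)] by (simp_all add: s_def)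
  have "p = chart s (u, l)"
    using chart_anc[OF s(1), of l u] s(2) t(3) by simp
  then have "\<exists>t. t \<in> T \<and> (\<exists>u l. lev l = ht t \<and> p = chart t (u, l))"
    using le_in[OF s(1)] s(2)[symmetric] by (intro exI[of _ s] conjI exI[of _ u] exI[of _ l]) simp_all
  note * = someI_ex[OF this, folded tip_def]
  show "tip p \<in> T"
    using * by (rule conjunct1)
  show "\<exists>u l. lev l = ht (tip p) \<and> p = chart (tip p) (u, l)"
    using * by (rule conjunct2)
qed

lemma tip_chart:
  assumes "t \<in> T" "lev l \<le> ht t"
  shows "underS r (tip (chart t (u, l))) = underS r (anc t (lev l))"
proof -
  have p: "chart t (u, l) \<in> points"
    using assms by (intro chart_in_points) simp_all
  define s where "s = tip (chart t (u, l))"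
  obtain u' l' where s: "s \<in> T" "lev l' = ht s" "chart t (u, l) = chart s (u', l')"
    using tip[OF p] unfolding s_def[symmetric] by blast
  have le: "lev l' \<le> ht s"
    using s(2) by simp
  have "l = l'" "underS r (anc t (lev l)) = underS r (anc s (lev l))"
    using iffD1[OF chart_eq_iff[OF assms(1) s(1) assms(2) le] s(3)] by blast+
  then have "underS r (anc t (lev l)) = underS r s"
    using anc_self[OF s(1)] s(2) by simp
  then show ?thesis
    by (simp add: s_def)
qed

lemma height_chart:
  assumes "t \<in> T" "lev l \<le> ht t"
  shows "height (chart t (u, l)) = l"
  using ht_cong[OF tip_chart[OF assms, of u]] anc(2)[OF assms]
  by (simp add: height_def) (simp add: chart_def)

lemma lev_height:
  assumes "p \<in> points"
  shows "lev (height p) = ht (tip p)"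
proof -
  obtain u l where ul: "lev l = ht (tip p)" "p = chart (tip p) (u, l)"
    using tip(2)[OF assms] by blast
  then have "height p = l"
    using height_chart[of "tip p" l u] tip(1)[OF assms] by simp
  then show ?thesis using ul(1) by simp
qed

lemma continuous_height: "continuous_map X euclidean height"
proof (rule continuous_map_X_I)
  fix t assume t: "t \<in> T"
  have c: "continuous_on (chart_dom t) snd"
    by (intro continuous_intros)
  have e: "height (chart t z) = snd z" if "z \<in> chart_dom t" for z
    using height_chart[OF t, of "snd z" "fst z"] that by (cases z) simp
  show "continuous_on (chart_dom t) (\<lambda>z. height (chart t z))"
    by (rule continuous_on_eq[OF c e[symmetric]])
qed

lemma points_unbounded: "\<exists>p\<in>points. \<alpha> < lev (height p)"
proof -
  obtain t where t: "t \<in> T" "\<alpha> < ht t"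
    using uncountable_ht_unbounded[OF subset_refl uncountable_T, of \<alpha>] by blast
  have "chart t (0, lray (ht t) 0) \<in> points"
    using t(1) by (intro chart_in_points) simp_all
  then show ?thesis
    using t height_chart[OF t(1), of "lray (ht t) 0" 0] by (intro bexI) simp_all
qed

text \<open>Translates boundedness in the surface into countability in the tree: only countably many
  nodes have height at most a given level, and countably many heights have a common bound.\<close>

lemma bounded_iff_countable_tip:
  assumes "D \<subseteq> points"
  shows "bounded_wrt cover D \<longleftrightarrow> countable (tip ` D)"
proof
  assume "bounded_wrt cover D"
  then obtain \<alpha> where "D \<subseteq> cover \<alpha>" by (auto simp: bounded_wrt_def)
  then have "tip ` D \<subseteq> {t \<in> T. ht t \<le> \<alpha>}"
    using tip(1) lev_height by (force simp: cover_def)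
  then show "countable (tip ` D)"
    using countable_ht_le countable_subset by blast
next
  assume "countable (tip ` D)"
  then obtain \<beta> where \<beta>: "\<And>\<alpha>. \<alpha> \<in> ht ` tip ` D \<Longrightarrow> \<alpha> < \<beta>"
    using countable_omega1_bounded[OF countable_image[of "tip ` D" ht]] by blast
  have "D \<subseteq> cover \<beta>"
    using \<beta> lev_height assms by (auto simp: cover_def)
  then show "bounded_wrt cover D"
    by (auto simp: bounded_wrt_def)
qed

lemma cover_closure: "X closure_of cover \<alpha> \<subseteq> {p \<in> points. height p \<le> lray \<alpha> 0}"
proof (rule closure_of_minimal)
  show "cover \<alpha> \<subseteq> {p \<in> points. height p \<le> lray \<alpha> 0}"
    by (auto simp: cover_def simp flip: less_lray_0_iff)
  show "closedin X {p \<in> points. height p \<le> lray \<alpha> 0}"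
    using closedin_continuous_map_preimage[OF continuous_height, of "{..lray \<alpha> 0}"] by simp
qed

text \<open>The closure lies in the union of the countably many patches over nodes of height at most
  \<alpha>, each of them Lindelof as a half-plane.\<close>

lemma Lindelof_cover_closure: "Lindelof_space (subtopology X (X closure_of cover \<alpha>))"
proof -
  define \<T> where "\<T> = patch ` {t \<in> T. ht t \<le> \<alpha>}"
  have "countable \<T>"
    unfolding \<T>_def by (intro countable_image countable_ht_le)
  then have Lin: "Lindelof_space (subtopology X (\<Union>\<T>))"
    by (rule Lindelof_space_Union) (auto simp: \<T>_def Lindelof_patch)
  have sub: "X closure_of cover \<alpha> \<subseteq> \<Union>\<T>"
  proof
    fix p assume "p \<in> X closure_of cover \<alpha>"
    then have p: "p \<in> points" "height p \<le> lray \<alpha> 0"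
      using cover_closure by blast+
    then have "ht (tip p) \<le> \<alpha>"
      using lev_height by (auto simp: le_long_ray_iff)
    moreover have "p \<in> patch (tip p)"
      using tip(2)[OF p(1)] by (auto simp: patch_def)
    ultimately show "p \<in> \<Union>\<T>"
      using tip(1)[OF p(1)] by (auto simp: \<T>_def)
  qed
  have "closedin (subtopology X (\<Union>\<T>)) (X closure_of cover \<alpha>)"
    using sub by (intro closedin_subset_topspace) simp_all
  then have "Lindelof_space (subtopology (subtopology X (\<Union>\<T>)) (X closure_of cover \<alpha>))"
    by (rule Lindelof_space_closedin_subtopology[OF Lin])
  then show ?thesis
    using sub by (simp add: subtopology_subtopology inf_absorb2)
qed

lemma type_I_X: "type_I_space X cover"
  unfolding type_I_space_def
proof (intro conjI allI impI Hausdorff_X Lindelof_cover_closure)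
  have op: "openin X (cover \<alpha>)" for \<alpha>
    using openin_continuous_map_preimage[OF continuous_height, of "{..<lray \<alpha> 0}"]
    by (simp add: cover_def)
  then show "openin X (cover \<alpha>)" for \<alpha> .
  have mem: "p \<in> cover (omega1_suc (lev (height p)))" if "p \<in> points" for p
    using that by (simp add: cover_def)
  then have "points \<subseteq> (\<Union>\<alpha>. cover \<alpha>)" by blast
  then show un: "topspace X = (\<Union>\<alpha>. cover \<alpha>)"
    unfolding topspace_X by (rule antisym) (simp add: cover_def UN_subset_iff)
  show "X closure_of cover \<alpha> \<subseteq> cover \<beta>" if "\<alpha> < \<beta>" for \<alpha> \<beta>
  proof
    fix p assume "p \<in> X closure_of cover \<alpha>"
    then have "p \<in> {p \<in> points. height p \<le> lray \<alpha> 0}"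
      by (rule subsetD[OF cover_closure])
    then show "p \<in> cover \<beta>"
      using that by (auto simp: cover_def le_long_ray_iff)
  qed
  \<comment> \<open>Countably many members of the cover have indices with a common bound, while
    there are points beyond every level.\<close>
  show "\<not> Lindelof_space X"
  proof
    assume "Lindelof_space X"
    then have "\<exists>\<V>. countable \<V> \<and> \<V> \<subseteq> range cover \<and> \<Union>\<V> = topspace X"
    proof (rule Lindelof_spaceD)
      show "openin X W" if "W \<in> range cover" for W
        using that op by auto
      show "\<Union>(range cover) = topspace X"
        by (rule un[symmetric])
    qed
    then obtain \<V> where V: "countable \<V>" "\<V> \<subseteq> range cover" "\<Union>\<V> = points"
      unfolding topspace_X by (elim exE conjE)
    have "\<exists>B. countable B \<and> B \<subseteq> UNIV \<and> \<V> = cover ` B"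
      using V(1,2) by (intro iffD1[OF countable_subset_image] conjI)
    then obtain B where B: "countable B" "\<V> = cover ` B" by (elim exE conjE)
    obtain \<beta> where \<beta>: "\<And>\<alpha>. \<alpha> \<in> B \<Longrightarrow> \<alpha> < \<beta>"
      using countable_omega1_bounded[OF B(1)] by blast
    obtain p where "p \<in> points" "\<beta> < lev (height p)"
      using points_unbounded by blast
    moreover from this obtain \<alpha> where "\<alpha> \<in> B" "p \<in> cover \<alpha>"
      unfolding V(3)[symmetric] B(2) by auto
    ultimately show False
      using \<beta>[of \<alpha>] by (simp add: cover_def)
  qed
qed

section \<open>Parts above a node and the failure of directions\<close>

text \<open>Independent of the choice in \<open>tip\<close>, since
  \<open>s \<sqsubset> tip p\<close> depends only on the predecessors of the tip.\<close>

definition above :: "'a \<Rightarrow> (omega1 \<times> real \<times> real) set" where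
  "above s = {p \<in> points. s \<sqsubset> tip p}"

lemma chart_in_above_iff:
  assumes "t \<in> T" "lev l \<le> ht t"
  shows "chart t (u, l) \<in> above s \<longleftrightarrow> s \<sqsubset> t \<and> ht s < lev l"
proof -
  have "chart t (u, l) \<in> above s \<longleftrightarrow> s \<sqsubset> anc t (lev l)"
    using tip_chart[OF assms, of u] chart_in_points[of t "(u, l)"] assms by (simp add: above_def)
  also have "\<dots> \<longleftrightarrow> s \<sqsubset> t \<and> ht s < lev l"
  proof
    assume "s \<sqsubset> anc t (lev l)"
    then show "s \<sqsubset> t \<and> ht s < lev l"
      using less_le_trans[OF _ anc(1)[OF assms]] ht_less[of s "anc t (lev l)"] anc(2)[OF assms] by simp
  next
    assume s: "s \<sqsubset> t \<and> ht s < lev l"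
    then have "s \<sqsubseteq> t" by (simp add: less_iff)
    then show "s \<sqsubset> anc t (lev l)"
      using less_iff_ht_less[OF _ anc(1)[OF assms], of s] anc(2)[OF assms] s by simp
  qed
  finally show ?thesis .
qed

text \<open>The region above \<open>s\<close> begins at height \<kappa>. In a chart over a node
  above \<open>s\<close> the function is the maximum of \<kappa> and the height; every other chart
  misses the region, and there it is constant.\<close>

lemma continuous_max_height_above:
  assumes "\<kappa> = lray (omega1_suc (ht s)) 0"
  shows "continuous_map X euclidean (\<lambda>p. if p \<in> above s then height p else \<kappa>)"
proof (rule continuous_map_X_I)
  fix t assume t: "t \<in> T"
  show "continuous_on (chart_dom t) (\<lambda>z. if chart t z \<in> above s then height (chart t z) else \<kappa>)"
  proof (cases "s \<sqsubset> t")
    case True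
    have e: "(if chart t z \<in> above s then height (chart t z) else \<kappa>) = max \<kappa> (snd z)"
      if "z \<in> chart_dom t" for z
    proof -
      obtain u l where z: "z = (u, l)" by fastforce
      then have l: "lev l \<le> ht t" using that by simp
      have "\<kappa> \<le> l \<longleftrightarrow> ht s < lev l"
        by (simp add: assms)
      then show ?thesis
        using chart_in_above_iff[OF t l, of u s] height_chart[OF t l, of u] True z
        by (simp add: max_def)
    qed
    have c: "continuous_on (chart_dom t) (\<lambda>z. max \<kappa> (snd z))"
      by (intro continuous_intros)
    show ?thesis
      by (rule continuous_on_eq[OF c e[symmetric]])
  next
    case False
    have e: "(if chart t z \<in> above s then height (chart t z) else \<kappa>) = \<kappa>"
      if "z \<in> chart_dom t" for z
    proof -
      obtain u l where z: "z = (u, l)" by fastforce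
      then have l: "lev l \<le> ht t" using that by simp
      show ?thesis
        using chart_in_above_iff[OF t l, of u s] False z by simp
    qed
    show ?thesis
      by (rule continuous_on_eq[OF continuous_on_const e[symmetric]])
  qed
qed

text \<open>In a chart over a node above \<open>s\<close> the complement consists of the levels up
  to \<open>ht s\<close>, an open strip; in any other chart it is everything.\<close>

lemma closedin_above: "closedin X (above s)"
proof -
  have "open (chart_dom t \<inter> chart t -` (points - above s))" if t: "t \<in> T" for t
  proof (cases "s \<sqsubset> t")
    case True
    have "chart_dom t \<inter> chart t -` (points - above s) = chart_dom t \<inter> UNIV \<times> {l. lev l \<le> ht s}"
    proof (intro set_eqI)
      fix z :: "real \<times> long_ray"
      obtain u l where z: "z = (u, l)" by fastforce
      show "z \<in> chart_dom t \<inter> chart t -` (points - above s) \<longleftrightarrow> z \<in> chart_dom t \<inter> UNIV \<times> {l. lev l \<le> ht s}"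
      proof (cases "lev l \<le> ht t")
        case l: True
        then have "chart t (u, l) \<in> points"
          using chart_in_points[OF t] by simp
        then show ?thesis
          using chart_in_above_iff[OF t l, of u s] True z by (simp add: not_less)
      qed (simp add: z)
    qed
    then show ?thesis
      using open_dom by (auto intro!: open_Int open_Times open_lev_le)
  next
    case False
    have "chart_dom t \<inter> chart t -` (points - above s) = chart_dom t"
      using chart_in_above_iff[OF t] chart_in_points[OF t] False unfolding chart_dom_def by blast
    then show ?thesis
      using open_dom by simp
  qed
  then have "openin X (points - above s)"
    by (simp add: openin_X)
  moreover have "above s \<subseteq> points"
    by (auto simp: above_def)
  ultimately show ?thesis
    by (simp add: closedin_def)
qed

lemma no_direction: "\<not> direction_in X cover D"
proof
  assume "direction_in X cover D"
  then have D: "closedin X D" "\<not> bounded_wrt cover D"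
    and dir: "\<forall>f :: _ \<Rightarrow> long_ray. continuous_map X euclidean f \<longrightarrow>
      \<not> bounded_wrt long_ray_below (f ` D) \<longrightarrow>
      (\<forall>C \<subseteq> D. club_in X cover C \<longrightarrow> \<not> bounded_wrt long_ray_below (f ` C))"
    unfolding direction_in_def club_in_def[of X cover D] by simp_all
  have DP: "D \<subseteq> points"
    using closedin_subset[OF D(1)] by simp
  then have tipD: "uncountable (tip ` D)" "tip ` D \<subseteq> T"
    using D(2) bounded_iff_countable_tip[OF DP] tip(1) by auto
  obtain s s' where "s \<in> T" "s' \<in> T" and s: "\<not> s \<sqsubseteq> s'" "\<not> s' \<sqsubseteq> s"
      "uncountable {t \<in> tip ` D. s \<sqsubset> t}" "uncountable {t \<in> tip ` D. s' \<sqsubset> t}"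
    by (rule uncountable_splits[OF tipD(2,1)])
  have unb: "\<not> bounded_wrt cover (D \<inter> above a)" if "uncountable {t \<in> tip ` D. a \<sqsubset> t}" for a
  proof -
    have "{t \<in> tip ` D. a \<sqsubset> t} = tip ` (D \<inter> above a)"
      using DP by (auto simp: above_def)
    moreover have "D \<inter> above a \<subseteq> points"
      using DP by (rule le_infI1)
    ultimately show ?thesis
      using that bounded_iff_countable_tip by simp
  qed
  define \<kappa> where "\<kappa> = lray (omega1_suc (ht s)) 0"
  define f where "f p = (if p \<in> above s then height p else \<kappa>)" for p
  have f: "continuous_map X euclidean f"
    unfolding f_def by (rule continuous_max_height_above[OF \<kappa>_def])
  have fD: "\<not> bounded_wrt long_ray_below (f ` D)"
  proof
    assume "bounded_wrt long_ray_below (f ` D)"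
    then obtain \<alpha> where \<alpha>: "\<forall>p\<in>D. lev (f p) < \<alpha>"
      by (auto simp: bounded_wrt_def long_ray_below_eq)
    \<comment> \<open>Above \<open>s\<close> the function is the height itself, so a bound for
      \<open>f\<close> would bound that part of \<open>D\<close>.\<close>
    have "D \<inter> above s \<subseteq> cover \<alpha>"
    proof
      fix p assume p: "p \<in> D \<inter> above s"
      then have "lev (height p) < \<alpha>" using \<alpha> by (force simp: f_def)
      then show "p \<in> cover \<alpha>" using p by (simp add: cover_def above_def)
    qed
    then show False
      using unb[OF s(3)] by (auto simp: bounded_wrt_def)
  qed
  have "club_in X cover (D \<inter> above s')"
    unfolding club_in_def using unb[OF s(4)] closedin_above D(1) by (simp add: closedin_Int)
  then have "\<not> bounded_wrt long_ray_below (f ` (D \<inter> above s'))"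
    using dir[rule_format, OF f fD Int_lower1] by simp
  \<comment> \<open>No node lies above both \<open>s\<close> and \<open>s'\<close>, as the
    predecessors of a node are comparable; so \<open>f\<close> keeps its default value on this
    club.\<close>
  moreover have "f p = \<kappa>" if "p \<in> D \<inter> above s'" for p
  proof -
    have "\<not> s \<sqsubset> tip p"
      using that s(1,2) le_linear[of s "tip p" s'] by (auto simp: above_def less_iff)
    then show ?thesis by (simp add: f_def above_def)
  qed
  then have "f ` (D \<inter> above s') \<subseteq> long_ray_below (omega1_suc (lev \<kappa>))"
    by (auto simp: long_ray_below_eq)
  ultimately show False
    by (auto simp: bounded_wrt_def)
qed

section \<open>Countability of closed discrete sets\<close>

lemma isolating_nhd:
  assumes "closedin X S" "subtopology X S = discrete_topology S" "p \<in> points"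
  obtains W where "openin X W" "p \<in> W" "W \<inter> S \<subseteq> {p}"
proof (cases "p \<in> S")
  case True
  then have "openin (subtopology X S) {p}"
    by (simp add: assms(2))
  then obtain W where "openin X W" "{p} = W \<inter> S"
    by (auto simp: openin_subtopology)
  then show ?thesis
    by (intro that[of W]) auto
next
  case False
  show ?thesis
  proof (rule that)
    show "openin X (topspace X - S)"
      using assms(1) by (intro openin_diff openin_topspace)
  qed (use False assms(3) in auto)
qed

lemma omega1_compact_X: "omega1_compact X"
  unfolding omega1_compact_def
proof (intro allI impI, elim conjE, rule ccontr)
  fix S assume S: "closedin X S" "subtopology X S = discrete_topology S" "uncountable S"
  have SP: "S \<subseteq> points"
    using closedin_subset[OF S(1)] by simp
  \<comment> \<open>With only countably many tips \<open>S\<close> would be bounded, hence a closed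
    discrete subset of a Lindelof space, hence countable.\<close>
  have "uncountable (tip ` S)"
  proof
    assume "countable (tip ` S)"
    then obtain \<alpha> where "S \<subseteq> cover \<alpha>"
      using bounded_iff_countable_tip[OF SP] by (auto simp: bounded_wrt_def)
    then have sub: "S \<subseteq> X closure_of cover \<alpha>"
      using closure_of_subset[of "cover \<alpha>" X] by (auto simp: cover_def)
    then have "closedin (subtopology X (X closure_of cover \<alpha>)) S"
      using S(1) by (intro closedin_subset_topspace)
    then have "Lindelof_space (subtopology (subtopology X (X closure_of cover \<alpha>)) S)"
      by (intro Lindelof_space_closedin_subtopology Lindelof_cover_closure)
    then have "Lindelof_space (discrete_topology S)"
      using sub by (simp add: subtopology_subtopology inf_absorb2 S(2))
    then obtain \<V> where V: "countable \<V>" "\<V> \<subseteq> (\<lambda>x. {x}) ` S" "\<Union>\<V> = S"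
      using Lindelof_spaceD[of "discrete_topology S" "(\<lambda>x. {x}) ` S"] by auto
    have "countable (\<Union>x\<in>\<V>. x)"
      by (rule countable_UN[OF V(1)]) (use V(2) in auto)
    then show False
      using V(3) S(3) by simp
  qed
  define A where "A = tip ` S"
  have AT: "A \<subseteq> T" using tip(1) SP by (auto simp: A_def)
  have "\<forall>t\<in>A. \<exists>u l. lev l = ht t \<and> chart t (u, l) \<in> S"
  proof
    fix t assume "t \<in> A"
    then obtain p where p: "p \<in> S" "t = tip p" by (auto simp: A_def)
    then obtain u l where "lev l = ht t" "p = chart t (u, l)"
      using tip(2)[of p] SP by blast
    then show "\<exists>u l. lev l = ht t \<and> chart t (u, l) \<in> S"
      using p(1) by blast
  qed
  \<comment> \<open>One point of \<open>S\<close> is kept for each tip \<open>t\<close>, at first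
    coordinate \<open>u t\<close> and height \<open>l t\<close>.\<close>
  from bchoice[OF this] obtain u where "\<forall>t\<in>A. \<exists>l. lev l = ht t \<and> chart t (u t, l) \<in> S" ..
  from bchoice[OF this] obtain l where ul: "\<forall>t\<in>A. lev (l t) = ht t \<and> chart t (u t, l t) \<in> S" ..
  \<comment> \<open>Some bound \<open>n\<close> on the first coordinates still leaves uncountably
    many tips; it provides the compact interval used at the end.\<close>
  have "A = (\<Union>n. {t \<in> A. \<bar>u t\<bar> \<le> real n})"
    using real_arch_simple by auto
  moreover have "countable (\<Union>n. {t \<in> A. \<bar>u t\<bar> \<le> real n})" if "\<forall>n. countable {t \<in> A. \<bar>u t\<bar> \<le> real n}"
    by (rule countable_UN) (use that in simp_all)
  ultimately obtain n where n: "uncountable {t \<in> A. \<bar>u t\<bar> \<le> real n}"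
    using \<open>uncountable (tip ` S)\<close> unfolding A_def[symmetric] by auto
  define B where "B = {t \<in> A. \<bar>u t\<bar> \<le> real n}"
  have "B \<subseteq> T" using AT by (auto simp: B_def)
  then obtain t s where t: "s \<sqsubset> t" and acc: "\<And>v. v \<sqsubset> t \<Longrightarrow> \<exists>a\<in>B. v \<sqsubset> a \<and> a \<sqsubset> t"
    using uncountable_accumulates[of B] n unfolding B_def[symmetric] by metis
  have tT: "t \<in> T" using less_in[OF t] by simp
  \<comment> \<open>The points \<open>(x, b)\<close> form the bottom line of the node
    \<open>t\<close>, the line that the chosen points over \<open>B\<close> approach from
    below.\<close>
  define b where "b = lray (ht t) 0"
  \<comment> \<open>Around each point of the bottom line, discreteness yields a box free of the
    chosen points from nodes of \<open>B\<close> between \<open>v\<close> and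
    \<open>t\<close>.\<close>
  have "\<forall>x. \<exists>J v. open J \<and> x \<in> J \<and> v \<sqsubset> t \<and> (\<forall>a\<in>B. v \<sqsubset> a \<longrightarrow> a \<sqsubset> t \<longrightarrow> u a \<notin> J)"
  proof
    fix x
    have xb: "(x, b) \<in> chart_dom t" by (simp add: b_def)
    obtain W where W: "openin X W" "chart t (x, b) \<in> W" "W \<inter> S \<subseteq> {chart t (x, b)}"
      using isolating_nhd[OF S(1,2) chart_in_points[OF tT xb]] by blast
    have "open (chart_dom t \<inter> chart t -` W)"
      using W(1) tT by (simp add: openin_X)
    moreover have "(x, b) \<in> chart_dom t \<inter> chart t -` W"
      using xb W(2) by simp
    ultimately obtain J K where JK: "open J" "open K" "(x, b) \<in> J \<times> K" "J \<times> K \<subseteq> chart_dom t \<inter> chart t -` W"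
      by (rule open_prod_elim)
    \<comment> \<open>The rule \<open>open_left\<close> asks for some point below \<open>b\<close>;
      the predecessor \<open>s\<close> of \<open>t\<close> provides one.\<close>
    have "lray (ht s) 0 < b"
      using ht_less[OF t] by (simp add: b_def)
    then obtain m where m: "m < b" "{m<..b} \<subseteq> K"
      using open_left[OF JK(2)] JK(3) by blast
    then have "lev m < ht t" by (simp add: b_def)
    then obtain v where v: "v \<sqsubseteq> t" "ht v = lev m"
      using ht_surj[OF tT, of "lev m"] less_imp_le by blast
    have "v \<sqsubset> t" using v \<open>lev m < ht t\<close> by (auto simp: less_iff)
    moreover have "u a \<notin> J" if a: "a \<in> B" "v \<sqsubset> a" "a \<sqsubset> t" for a
    proof
      assume J: "u a \<in> J"
      have la: "lev (l a) = ht a" "chart a (u a, l a) \<in> S"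
        using ul a(1) by (auto simp: B_def)
      have "ht v < ht a" "ht a < ht t"
        using ht_less a by simp_all
      then have "m < l a" "l a < b"
        using la(1) v(2) by (simp_all add: less_long_ray_iff b_def)
      then have "(u a, l a) \<in> J \<times> K"
        using J m(2) by auto
      then have "chart t (u a, l a) \<in> W"
        using JK(4) by blast
      moreover have eq: "chart a (u a, l a) = chart t (u a, l a)"
        using a(3) la(1) by (intro chart_anc) (simp_all add: less_iff)
      \<comment> \<open>The set \<open>W\<close> may meet \<open>S\<close> in
        \<open>chart t (x, b)\<close> itself, but the point over \<open>a\<close> has height less
        than \<open>b\<close> and is a different one.\<close>
      ultimately have "chart t (u a, l a) = chart t (x, b)"
        using W(3) la(2) by auto
      then have "l a = b"
        using chart_eq_iff[OF tT tT, of "l a" b "u a" x] la(1) \<open>ht a < ht t\<close> by (simp add: b_def)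
      then show False using \<open>l a < b\<close> by simp
    qed
    ultimately show "\<exists>J v. open J \<and> x \<in> J \<and> v \<sqsubset> t \<and> (\<forall>a\<in>B. v \<sqsubset> a \<longrightarrow> a \<sqsubset> t \<longrightarrow> u a \<notin> J)"
      using JK(1,3) by (intro exI[of _ J] exI[of _ v]) simp
  qed
  from choice[OF this] obtain J where
    "\<forall>x. \<exists>v. open (J x) \<and> x \<in> J x \<and> v \<sqsubset> t \<and> (\<forall>a\<in>B. v \<sqsubset> a \<longrightarrow> a \<sqsubset> t \<longrightarrow> u a \<notin> J x)" ..
  from choice[OF this] obtain v where Jv: "\<forall>x. open (J x) \<and> x \<in> J x \<and> v x \<sqsubset> t \<and>
      (\<forall>a\<in>B. v x \<sqsubset> a \<longrightarrow> a \<sqsubset> t \<longrightarrow> u a \<notin> J x)" ..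
  \<comment> \<open>Finitely many boxes cover the bounded part of the bottom line. The highest of
    their nodes \<open>v x\<close> is still below \<open>t\<close>, so some \<open>a\<close> in
    \<open>B\<close> lies between it and \<open>t\<close>, and its point falls into one of the
    boxes.\<close>
  obtain C where C: "finite C" "{- real n..real n} \<subseteq> (\<Union>x\<in>C. J x)"
    by (rule compactE_image[of "{- real n..real n}" "{- real n..real n}" J]) (use Jv in auto)
  have "C \<noteq> {}" using C(2) by auto
  then have "Max ((\<lambda>x. ht (v x)) ` C) \<in> (\<lambda>x. ht (v x)) ` C"
    using C(1) by (intro Max_in) simp_all
  then obtain y where y: "y \<in> C" "Max ((\<lambda>x. ht (v x)) ` C) = ht (v y)" by blast
  have max: "ht (v x) \<le> ht (v y)" if "x \<in> C" for x
    unfolding y(2)[symmetric] using C(1) that by (intro Max_ge) simp_all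
  obtain a where a: "a \<in> B" "v y \<sqsubset> a" "a \<sqsubset> t"
    using acc Jv by blast
  have "u a \<in> {- real n..real n}"
    using a(1) by (auto simp: B_def abs_le_iff)
  then obtain x where x: "x \<in> C" "u a \<in> J x"
    using C(2) by blast
  have "ht (v x) < ht a"
    using max[OF x(1)] ht_less[OF a(2)] by (rule order.strict_trans1)
  then have "v x \<sqsubset> a"
    using less_iff_ht_less[of "v x" t a] Jv a(3) by (simp add: less_iff)
  then show False
    using Jv a x(2) by blast
qed

end

theorem theorem3p5:
  assumes "\<exists>(T :: 'a set) r. suslin_tree T r"
  shows "\<exists>(X :: (omega1 \<times> real \<times> real) topology) U.
           surface X \<and> type_I_space X U \<and> omega1_compact X \<and>
           \<not> (\<exists>D. direction_in X U D)"
proof -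
  obtain T :: "'a set" and r where "suslin_tree T r"
    using assms by blast
  then interpret suslin T r
    by unfold_locales
  show ?thesis
    using surface_X type_I_X omega1_compact_X no_direction by blast
qed

end
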